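(* Let $p_1$ be any mesh pattern, and let $p$ be the mesh pattern obtained from the mesh pattern $(12,\{(0,0),(0,1),(1,0),(1,2),(2,1),(2,2)\})$ by inserting $p_1$ in the box $(1,1)$. Then $$A_p(x)=\frac{F(x)}{1+x^2\big(F(x)-A_{p_1}(x)\big)F(x)},\qquad F_p(x,q)=\frac{F(x)}{1+x^2\big(F(x)-F_{p_1}(x,q)\big)F(x)}.$$
   Context: $S_n$ is the set of permutations of $\{1,\dots,n\}$, $n\ge 0$ ($S_0$ consists of the empty permutation). A mesh pattern of length $k$ is a pair $(\tau,R)$ with $\tau\in S_k$ and $R\subseteq\{0,\dots,k\}\times\{0,\dots,k\}$ (the shaded boxes). Given $\pi=\pi_1\cdots\pi_n\in S_n$ and positions $i_1<\dots<i_k$, let $v_1<\dots<v_k$ be the values $\pi_{i_1},\dots,\pi_{i_k}$ sorted increasingly, and put $i_0=v_0=0$, $i_{k+1}=v_{k+1}=n+1$. The box $(r,s)$ contains the elements $\pi_j$ with $i_r<j<i_{r+1}$ and $v_s<\pi_j<v_{s+1}$. The subsequence $\pi_{i_1}\cdots\pi_{i_k}$ is an occurrence of $(\tau,R)$ if it is order-isomorphic to $\tau$ and every box in $R$ contains no element of $\pi$. The empty pattern ($k=0$, $R=\emptyset$) is allowed and has exactly one occurrence in every permutation. Insertion of patterns: if mesh patterns are inserted in some unshaded boxes of a base mesh pattern, an occurrence of the resulting mesh pattern in $\pi$ consists of an occurrence of the base pattern in $\pi$ together with, for each inserted pattern, an occurrence of it in the permutation order-isomorphic to the sequence of all elements of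 $\pi$ lying in the corresponding box (unshaded boxes in which nothing is inserted are unrestricted). For a mesh pattern $p$, $p(\pi)$ is the number of occurrences of $p$ in $\pi$, $F_p(x,q)=\sum_{n\ge0}x^n\sum_{\pi\in S_n}q^{p(\pi)}$, $A_p(x)=\sum_{n\ge 0}x^n\,|\{\pi\in S_n: p(\pi)=0\}|$, and $F(x)=\sum_{n\ge0}n!\,x^n$. All are formal power series. *)

theory Defs
  imports
    "HOL-Combinatorics.Multiset_Permutations"
    "HOL-Computational_Algebra.Formal_Power_Series"
begin

section \<open>Permutations in one-line notation\<close>

abbreviation perms :: "nat \<Rightarrow> nat list set" where
  "perms n \<equiv> permutations_of_set {1..n}"

text \<open>Positions are counted from 1, as in \<open>\<pi>\<^sub>1 \<dots> \<pi>\<^sub>n\<close>.\<close>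

definition entry :: "nat list \<Rightarrow> nat \<Rightarrow> nat" where
  "entry \<pi> j = \<pi> ! (j - 1)"

text \<open>The subsequence of \<open>\<pi>\<close> at the positions in the finite set \<open>I\<close>, read from left to right.\<close>

definition subword :: "nat list \<Rightarrow> nat set \<Rightarrow> nat list" where
  "subword \<pi> I = map (entry \<pi>) (sorted_list_of_set I)"

definition order_isomorphic :: "nat list \<Rightarrow> nat list \<Rightarrow> bool" where
  "order_isomorphic u w \<longleftrightarrow> length u = length w \<and>
     (\<forall>a<length u. \<forall>b<length u. u ! a < u ! b \<longleftrightarrow> w ! a < w ! b)"

text \<open>The permutation order-isomorphic to a word without repeated letters.\<close>

definition standardize :: "nat list \<Rightarrow> nat list" where
  "standardize w = map (\<lambda>x. card {y \<in> set w. y \<le> x}) w"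

section \<open>Mesh patterns\<close>

type_synonym mesh_pattern = "nat list \<times> (nat \<times> nat) set"

definition is_mesh_pattern :: "mesh_pattern \<Rightarrow> bool" where
  "is_mesh_pattern p \<longleftrightarrow> fst p \<in> perms (length (fst p)) \<and>
     snd p \<subseteq> {0..length (fst p)} \<times> {0..length (fst p)}"

text \<open>For \<open>I = {i\<^sub>1 < \<dots> < i\<^sub>k}\<close> the lists \<open>i\<^sub>0, \<dots>, i\<^sub>k\<^sub>+\<^sub>1\<close> and \<open>v\<^sub>0, \<dots>, v\<^sub>k\<^sub>+\<^sub>1\<close>.\<close>

definition column_bounds :: "nat list \<Rightarrow> nat set \<Rightarrow> nat list" where
  "column_bounds \<pi> I = 0 # sorted_list_of_set I @ [length \<pi> + 1]"

definition row_bounds :: "nat list \<Rightarrow> nat set \<Rightarrow> nat list" where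
  "row_bounds \<pi> I = 0 # sorted_list_of_set (entry \<pi> ` I) @ [length \<pi> + 1]"

text \<open>The positions \<open>j\<close> of the elements \<open>\<pi>\<^sub>j\<close> lying in a box.\<close>

definition mesh_box :: "nat list \<Rightarrow> nat set \<Rightarrow> nat \<times> nat \<Rightarrow> nat set" where
  "mesh_box \<pi> I = (\<lambda>(r, s). {j \<in> {1..length \<pi>}.
     column_bounds \<pi> I ! r < j \<and> j < column_bounds \<pi> I ! Suc r \<and>
     row_bounds \<pi> I ! s < entry \<pi> j \<and> entry \<pi> j < row_bounds \<pi> I ! Suc s})"

text \<open>An occurrence is identified with its set of positions.\<close>

definition occurrences :: "mesh_pattern \<Rightarrow> nat list \<Rightarrow> nat set set" where
  "occurrences p \<pi> = {I. I \<subseteq> {1..length \<pi>} \<and> order_isomorphic (subword \<pi> I) (fst p) \<and>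
     (\<forall>b \<in> snd p. mesh_box \<pi> I b = {})}"

definition occ_count :: "mesh_pattern \<Rightarrow> nat list \<Rightarrow> nat" where
  "occ_count p \<pi> = card (occurrences p \<pi>)"

definition box_perm :: "nat list \<Rightarrow> nat set \<Rightarrow> nat \<times> nat \<Rightarrow> nat list" where
  "box_perm \<pi> I b = standardize (subword \<pi> (mesh_box \<pi> I b))"

text \<open>The position in \<open>\<pi>\<close> of the \<open>j\<close>th element in a box.\<close>

definition box_position :: "nat list \<Rightarrow> nat set \<Rightarrow> nat \<times> nat \<Rightarrow> nat \<Rightarrow> nat" where
  "box_position \<pi> I b j = sorted_list_of_set (mesh_box \<pi> I b) ! (j - 1)"

section \<open>Insertion of a mesh pattern in a box\<close>

text \<open>
  Inserting a pattern of length \<open>k\<close> in box \<open>(r, s)\<close> splits column \<open>r\<close> and row \<open>s\<close> of the grid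
  into \<open>k + 1\<close> columns and rows each; \<open>unsplit a k\<close> maps the new column (row) indices to the old
  ones, \<open>a\<close> being the column (row) that is split. A box of the new grid is shaded if the box of the
  base pattern containing it is shaded, or if it is a shaded box of the inserted pattern. That the
  occurrences of the resulting pattern are the pairs of an occurrence \<open>I\<close> of the base and an
  occurrence \<open>J\<close> of the inserted pattern in the contents of the box is the lemma
  \<open>occurrences_mesh_insert\<close> below.
\<close>

definition unsplit :: "nat \<Rightarrow> nat \<Rightarrow> nat \<Rightarrow> nat" where
  "unsplit a k c = (if c < a then c else if c \<le> a + k then a else c - k)"

definition mesh_insert :: "mesh_pattern \<Rightarrow> nat \<times> nat \<Rightarrow> mesh_pattern \<Rightarrow> mesh_pattern" where
  "mesh_insert base = (\<lambda>(r, s) p.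
     let m = length (fst base); k = length (fst p); up = (\<lambda>v. if v \<le> s then v else v + k) in
       (map up (take r (fst base)) @ map (\<lambda>v. s + v) (fst p) @ map up (drop r (fst base)),
        {(c, d). c \<le> m + k \<and> d \<le> m + k \<and> (unsplit r k c, unsplit s k d) \<in> snd base} \<union>
        (\<lambda>(c, d). (r + c, s + d)) ` snd p))"

section \<open>Generating functions\<close>

definition fact_gf :: "'a::semiring_1 fps" where
  "fact_gf = Abs_fps (\<lambda>n. of_nat (fact n))"

definition avoid_gf :: "mesh_pattern \<Rightarrow> rat fps" where
  "avoid_gf p = Abs_fps (\<lambda>n. of_nat (card {\<pi> \<in> perms n. occ_count p \<pi> = 0}))"

text \<open>
  A power series in \<open>x\<close> whose coefficients are power series in \<open>q\<close>: the variable \<open>q\<close> is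
  \<^term>\<open>fps_X :: rat fps\<close> and the variable \<open>x\<close> is \<^term>\<open>fps_X :: rat fps fps\<close>.
\<close>

definition distr_gf :: "mesh_pattern \<Rightarrow> rat fps fps" where
  "distr_gf p = Abs_fps (\<lambda>n. \<Sum>\<pi>\<in>perms n. fps_X ^ occ_count p \<pi>)"

text \<open>
  Division of power series in \<open>x\<close> over power series in \<open>q\<close> is the usual one for denominators with
  constant term 1.
\<close>

lemma fps_fps_divide_times:
  fixes f g :: "rat fps fps"
  assumes "fps_nth g 0 = 1"
  shows "f / g * g = f"
proof -
  have "g \<noteq> 0" using assms by auto
  have "subdegree g = 0" using assms by (intro subdegree_eq_0) simp
  then have "f / g = f * inverse g"
    by (simp add: fps_divide_def)
  moreover have "g * inverse g = 1"
    using fps_right_inverse[of g 1] assms fps_inverse_one[where 'a = rat]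
    unfolding fps_inverse_def[of g] by simp
  ultimately show ?thesis by (simp add: mult.assoc mult.commute[of _ g])
qed

section \<open>Occurrences of the pattern obtained by insertion\<close>

text \<open>
  The membership in a box and the order-isomorphism with a permutation are expressed by the number of
  chosen elements to the left of (with \<open>g = id\<close>) and below (with \<open>g = entry \<pi>\<close>) a given element.
\<close>

definition below_count :: "(nat \<Rightarrow> nat) \<Rightarrow> nat set \<Rightarrow> nat \<Rightarrow> nat" where
  "below_count g I x = card {a \<in> I. g a < g x}"

lemma rank_mono: "finite I \<Longrightarrow> g x \<le> g y \<Longrightarrow> below_count g I x \<le> below_count g I y"
  unfolding below_count_def by (rule card_mono) auto

lemma rank_strict_mono:
  "finite I \<Longrightarrow> x \<in> I \<Longrightarrow> g x < g y \<Longrightarrow> below_count g I x < below_count g I y"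
  unfolding below_count_def by (rule psubset_card_mono) auto

lemma rank_le_card: "finite I \<Longrightarrow> below_count g I x \<le> card I"
  unfolding below_count_def by (rule card_mono) auto

lemma rank_less_card: "finite I \<Longrightarrow> x \<in> I \<Longrightarrow> below_count g I x < card I"
  unfolding below_count_def by (rule psubset_card_mono) auto

lemma rank_less_iff:
  "finite I \<Longrightarrow> x \<in> I \<Longrightarrow> y \<in> I \<Longrightarrow> below_count g I x < below_count g I y \<longleftrightarrow> g x < g y"
  by (meson leD linorder_not_less rank_mono rank_strict_mono)

lemma rank_union:
  "finite I \<Longrightarrow> finite J \<Longrightarrow> I \<inter> J = {} \<Longrightarrow> below_count g (I \<union> J) x = below_count g I x + below_count g J x"
proof -
  assume "finite I" "finite J" "I \<inter> J = {}"
  moreover have "{a \<in> I \<union> J. g a < g x} = {a \<in> I. g a < g x} \<union> {a \<in> J. g a < g x}"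
    by auto
  ultimately show ?thesis
    unfolding below_count_def by (auto intro!: card_Un_disjoint)
qed

lemma rank_bij:
  assumes "finite K" "inj_on g K"
  shows "bij_betw (below_count g K) K {..<card K}"
proof -
  have inj: "inj_on (below_count g K) K"
  proof (rule inj_onI)
    fix x y assume *: "x \<in> K" "y \<in> K" "below_count g K x = below_count g K y"
    then have "g x = g y"
      using rank_less_iff[OF assms(1)] by (metis linorder_neqE_nat nat_neq_iff)
    with assms(2) * show "x = y" by (auto dest: inj_onD)
  qed
  moreover have "below_count g K ` K \<subseteq> {..<card K}"
    using rank_less_card[OF assms(1)] by auto
  moreover have "card (below_count g K ` K) = card {..<card K}"
    unfolding card_image[OF inj] card_lessThan ..
  ultimately have "below_count g K ` K = {..<card K}"
    by (intro card_subset_eq[OF finite_lessThan])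
  then show ?thesis using inj unfolding bij_betw_def by blast
qed

lemma card_rank_vimage:
  assumes "finite K" "inj_on g K" "S \<subseteq> {..<card K}"
  shows "card {x \<in> K. below_count g K x \<in> S} = card S"
proof -
  have b: "bij_betw (below_count g K) K {..<card K}" by (rule rank_bij) fact+
  have "below_count g K ` {x \<in> K. below_count g K x \<in> S} = S"
  proof -
    have "below_count g K ` {x \<in> K. below_count g K x \<in> S} = below_count g K ` K \<inter> S" by blast
    also have "\<dots> = S" unfolding bij_betw_imp_surj_on[OF b] using assms(3) by (rule Int_absorb1)
    finally show ?thesis .
  qed
  moreover have "inj_on (below_count g K) {x \<in> K. below_count g K x \<in> S}"
    using b by (auto simp: bij_betw_def inj_on_def)
  ultimately show ?thesis by (metis card_image)
qed

lemma rank_outer: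
  assumes "finite K" "inj_on g K" "r + k \<le> card K" "j \<in> K" "r \<le> below_count g K j" "below_count g K j < r + k"
  shows "below_count g {i \<in> K. below_count g K i < r \<or> r + k \<le> below_count g K i} j = r"
proof -
  have "{a \<in> {i \<in> K. below_count g K i < r \<or> r + k \<le> below_count g K i}. g a < g j} = {x \<in> K. below_count g K x \<in> {..<r}}"
    using rank_less_iff[OF assms(1) _ assms(4), of _ g] assms(5,6) by fastforce
  then show ?thesis
    unfolding below_count_def[of g "{i \<in> K. below_count g K i < r \<or> r + k \<le> below_count g K i}"] using card_rank_vimage[OF assms(1,2), of "{..<r}"] assms(3) by simp
qed

context
  fixes g :: "nat \<Rightarrow> nat" and I J :: "nat set" and r :: nat
  assumes fin: "finite I" "finite J" and disj: "I \<inter> J = {}"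
    and J: "\<And>j. j \<in> J \<Longrightarrow> below_count g I j = r"
begin

lemma rank_lt: "below_count g I x < r \<Longrightarrow> below_count g J x = 0"
proof -
  assume *: "below_count g I x < r"
  have "\<not> g a < g x" if "a \<in> J" for a
    using J[OF that] rank_mono[OF fin(1), of g a x] * by auto
  then have "{a \<in> J. g a < g x} = {}" by auto
  then show ?thesis unfolding below_count_def by (metis card.empty)
qed

lemma rank_gt: "below_count g I x > r \<Longrightarrow> below_count g J x = card J"
proof -
  assume *: "below_count g I x > r"
  have "g a < g x" if "a \<in> J" for a
    using J[OF that] rank_mono[OF fin(1), of g x a] * by (cases "g x \<le> g a") auto
  then have "{a \<in> J. g a < g x} = J" by auto
  then show ?thesis unfolding below_count_def by simp
qed

lemma rank_mem: 
  assumes "x \<in> I" "below_count g I x = r" "inj_on g (I \<union> J)"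
  shows "below_count g J x = card J"
proof -
  have "g a < g x" if "a \<in> J" for a
  proof (rule ccontr)
    assume "\<not> ?thesis"
    moreover have "g a \<noteq> g x" using that assms disj by (auto dest: inj_onD)
    ultimately have "below_count g I x < below_count g I a" using assms fin by (intro rank_strict_mono) auto
    with J[OF that] assms show False by simp
  qed
  then have "{a \<in> J. g a < g x} = J" by auto
  then show ?thesis unfolding below_count_def by simp
qed

lemma unsplit_rank: "unsplit r (card J) (below_count g (I \<union> J) x) = below_count g I x"
  using rank_lt[of x] rank_gt[of x] rank_le_card[OF fin(2), of g x]
  unfolding rank_union[OF fin disj] unsplit_def
  by (cases "below_count g I x" r rule: linorder_cases) auto

lemma rank_middle:
  "c \<le> card J \<Longrightarrow> below_count g (I \<union> J) x = r + c \<longleftrightarrow> below_count g I x = r \<and> below_count g J x = c"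
  using rank_lt[of x] rank_gt[of x] rank_le_card[OF fin(2), of g x]
  unfolding rank_union[OF fin disj]
  by (cases "below_count g I x" r rule: linorder_cases) auto

lemma rank_union_mem:
  "inj_on g (I \<union> J) \<Longrightarrow> x \<in> I \<Longrightarrow>
   below_count g (I \<union> J) x = (if below_count g I x < r then below_count g I x else below_count g I x + card J)"
  using rank_lt[of x] rank_gt[of x] rank_mem[of x]
  unfolding rank_union[OF fin disj]
  by (cases "below_count g I x" r rule: linorder_cases) auto

end

lemma ball_image: "(\<forall>i\<in>f ` {..<n}. Q i) \<longleftrightarrow> (\<forall>c<n. Q (f c))" for n :: nat
  by auto

lemma image_Collect_comp: "f ` {b \<in> N. P (f b)} = {v \<in> f ` N. P v}"
  by blast

lemma rank_nth_sorted_list: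
  assumes "finite A" "c < card A"
  shows "below_count id A (sorted_list_of_set A ! c) = c"
proof -
  let ?l = "sorted_list_of_set A"
  have len: "length ?l = card A" using assms by simp
  have sm: "?l ! a < ?l ! b \<longleftrightarrow> a < b" if "a < card A" "b < card A" for a b
    using that sorted_wrt_nth_less[OF strict_sorted_list_of_set[of A]] len
    by (metis linorder_neqE_nat not_less_iff_gr_or_eq)
  have "{a \<in> A. a < ?l ! c} = (!) ?l ` {..<c}"
  proof -
    have "A = (!) ?l ` {..<card A}"
      using bij_betw_imp_surj_on[OF bij_betw_nth[of ?l "{..<card A}" A]] assms(1) len by simp
    then have "{a \<in> A. a < ?l ! c} = {a \<in> (!) ?l ` {..<card A}. a < ?l ! c}" by simp
    also have "\<dots> = (!) ?l ` {b \<in> {..<card A}. ?l ! b < ?l ! c}"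
      by (rule image_Collect_comp[symmetric])
    also have "{b \<in> {..<card A}. ?l ! b < ?l ! c} = {..<c}"
      using sm assms(2) by auto
    finally show ?thesis .
  qed
  moreover have "inj_on ((!) ?l) {..<c}"
    using assms by (auto simp: inj_on_def nth_eq_iff_index_eq)
  ultimately show ?thesis by (simp add: below_count_def card_image)
qed

lemma bounds_rank:
  assumes "finite A" "r \<le> card A" "A \<subseteq> {1..n}" "x \<in> {1..n}"
  shows "(0 # sorted_list_of_set A @ [n + 1]) ! r < x \<and>
         x < (0 # sorted_list_of_set A @ [n + 1]) ! Suc r \<longleftrightarrow> x \<notin> A \<and> below_count id A x = r"
proof -
  let ?l = "sorted_list_of_set A"
  have len: "length ?l = card A" using assms by simp
  have lo: "(0 # ?l @ [n + 1]) ! r < x \<longleftrightarrow> r = 0 \<or> ?l ! (r - 1) < x"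
    using assms len by (cases r) (auto simp: nth_append)
  have hi: "x < (0 # ?l @ [n + 1]) ! Suc r \<longleftrightarrow> r = card A \<or> x < ?l ! r"
    using assms len by (auto simp: nth_append)
  have mem: "?l ! c \<in> A" if "c < card A" for c
    using that len assms(1) by (metis nth_mem set_sorted_list_of_set)
  have rk: "below_count id A (?l ! c) = c" if "c < card A" for c
    using rank_nth_sorted_list assms(1) that .
  have ge: "r = 0 \<or> ?l ! (r - 1) < x \<longleftrightarrow> r \<le> below_count id A x"
  proof (cases "r = 0")
    case False
    then have r: "r - 1 < card A" using assms by simp
    show ?thesis
    proof
      assume "r = 0 \<or> ?l ! (r - 1) < x"
      then show "r \<le> below_count id A x"
        using rank_strict_mono[OF assms(1) mem[OF r], of id x] rk[OF r] False by simp
    next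
      assume *: "r \<le> below_count id A x"
      show "r = 0 \<or> ?l ! (r - 1) < x"
      proof (rule ccontr)
        assume "\<not> ?thesis"
        then have "x \<le> ?l ! (r - 1)" by simp
        then have "below_count id A x \<le> r - 1" using rank_mono[OF assms(1), of id x "?l ! (r - 1)"] rk[OF r] by simp
        with * False show False by simp
      qed
    qed
  qed simp
  have le: "r = card A \<or> x < ?l ! r \<longleftrightarrow> (below_count id A x < r \<or> below_count id A x = r \<and> x \<notin> A)"
  proof (cases "r = card A")
    case True
    then show ?thesis using rank_le_card[OF assms(1), of id x] rank_less_card[OF assms(1), of x id] 
      by (auto simp: le_less)
  next
    case False
    then have r: "r < card A" using assms by simp
    show ?thesis
    proof
      assume "r = card A \<or> x < ?l ! r"
      then have *: "x < ?l ! r" using False by simp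
      then have "below_count id A x \<le> r" using rank_mono[OF assms(1), of id x "?l ! r"] rk[OF r] by simp
      moreover have "below_count id A x < r" if "x \<in> A"
        using rank_strict_mono[OF assms(1) that, of id "?l ! r"] rk[OF r] * by simp
      ultimately show "below_count id A x < r \<or> below_count id A x = r \<and> x \<notin> A" by fastforce
    next
      assume *: "below_count id A x < r \<or> below_count id A x = r \<and> x \<notin> A"
      show "r = card A \<or> x < ?l ! r"
      proof (rule ccontr)
        assume "\<not> ?thesis"
        then have le: "?l ! r \<le> x" by simp
        then have "r \<le> below_count id A x" using rank_mono[OF assms(1), of id "?l ! r" x] rk[OF r] by simp
        with * have e: "below_count id A x = r" "x \<notin> A" by auto
        with mem[OF r] have "?l ! r \<noteq> x" by auto
        with le have "?l ! r < x" by simp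
        then show False
          using rank_strict_mono[OF assms(1) mem[OF r], of id x] rk[OF r] e by simp
      qed
    qed
  qed
  show ?thesis unfolding lo hi ge le by auto
qed

lemma entry_bij:
  assumes "\<pi> \<in> perms n"
  shows "bij_betw (entry \<pi>) {1..n} {1..n}" "length \<pi> = n"
proof -
  have d: "set \<pi> = {1..n}" "distinct \<pi>" using assms by (auto dest: permutations_of_setD)
  then show len: "length \<pi> = n" using distinct_card by fastforce
  have "bij_betw ((!) \<pi>) {..<n} {1..n}" using d len by (metis bij_betw_nth)
  moreover have "bij_betw (\<lambda>j. j - 1) {1..n} {..<n}"
    by (rule bij_betw_byWitness[where f' = Suc]) auto
  ultimately have "bij_betw ((!) \<pi> \<circ> (\<lambda>j. j - 1)) {1..n} {1..n}" by (rule bij_betw_trans[rotated])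
  moreover have "(!) \<pi> \<circ> (\<lambda>j. j - 1) = entry \<pi>" by (auto simp: entry_def)
  ultimately show "bij_betw (entry \<pi>) {1..n} {1..n}" by simp
qed

lemma entry_inj:
  assumes "\<pi> \<in> perms n" "I \<subseteq> {1..n}"
  shows "inj_on (entry \<pi>) I"
  using entry_bij(1)[OF assms(1)] assms(2) by (meson bij_betw_imp_inj_on inj_on_subset)

lemma rank_image:
  assumes "\<And>a. a \<in> A \<Longrightarrow> g a < g x \<longleftrightarrow> h (f a) < h (f x)" "inj_on f A"
  shows "below_count h (f ` A) (f x) = below_count g A x"
proof -
  have "{a \<in> f ` A. h a < h (f x)} = f ` {a \<in> A. g a < g x}" using assms(1) by auto
  moreover have "inj_on f {a \<in> A. g a < g x}" using assms(2) by (auto simp: inj_on_def)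
  ultimately show ?thesis by (simp add: below_count_def card_image)
qed

lemma mem_mesh_box:
  assumes "\<pi> \<in> perms n" "I \<subseteq> {1..n}" "r \<le> card I" "s \<le> card I"
  shows "x \<in> mesh_box \<pi> I (r, s) \<longleftrightarrow>
    x \<in> {1..n} - I \<and> below_count id I x = r \<and> below_count (entry \<pi>) I x = s"
proof (cases "x \<in> {1..n}")
  case True
  note b = entry_bij[OF assms(1)]
  have fin: "finite I" using assms(2) finite_subset by blast
  have inj: "inj_on (entry \<pi>) {1..n}" using b by (auto simp: bij_betw_def)
  have img: "entry \<pi> ` I \<subseteq> {1..n}" "entry \<pi> x \<in> {1..n}"
    using b True assms(2) by (auto simp: bij_betw_def)
  have c: "card (entry \<pi> ` I) = card I" by (rule card_image[OF entry_inj[OF assms(1,2)]])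
  have "below_count id (entry \<pi> ` I) (entry \<pi> x) = below_count (entry \<pi>) I x"
    by (rule rank_image) (auto intro: entry_inj[OF assms(1,2)])
  moreover have "entry \<pi> x \<in> entry \<pi> ` I \<longleftrightarrow> x \<in> I"
    using inj True assms(2) by (auto dest: inj_onD)
  ultimately show ?thesis
    using bounds_rank[OF fin assms(3,2) True] bounds_rank[OF _ _ img, of s] fin True assms(4)
    unfolding mesh_box_def column_bounds_def row_bounds_def b(2) c by auto
next
  case False
  then show ?thesis using entry_bij(2)[OF assms(1)] by (auto simp: mesh_box_def)
qed

lemma order_isomorphic_iff:
  assumes "\<tau> \<in> perms (length \<tau>)" 
  shows "order_isomorphic u \<tau> \<longleftrightarrow>
    length u = length \<tau> \<and> (\<forall>c<length u. \<tau> ! c = Suc (card {b. b < length u \<and> u ! b < u ! c}))"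
proof -
  define k where "k = length \<tau>"
  have d: "set \<tau> = {1..k}" "distinct \<tau>"
    using assms by (auto simp: k_def dest: permutations_of_setD)
  have bij: "bij_betw ((!) \<tau>) {..<k} {1..k}" using d k_def by (metis bij_betw_nth)
  have r: "\<tau> ! c = Suc (card {b. b < k \<and> \<tau> ! b < \<tau> ! c})" if "c < k" for c
  proof -
    have "\<tau> ! c \<in> {1..k}" using that bij by (auto simp: bij_betw_def)
    then have "{1..<\<tau> ! c} = {v \<in> {1..k}. v < \<tau> ! c}" by auto
    also have "\<dots> = (!) \<tau> ` {b \<in> {..<k}. \<tau> ! b < \<tau> ! c}"
      using image_Collect_comp[of "(!) \<tau>" "{..<k}" "\<lambda>v. v < \<tau> ! c"]
      unfolding bij_betw_imp_surj_on[OF bij] by (rule sym)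
    finally have "{1..<\<tau> ! c} = (!) \<tau> ` {b. b < k \<and> \<tau> ! b < \<tau> ! c}" by simp
    moreover have "inj_on ((!) \<tau>) {b. b < k \<and> \<tau> ! b < \<tau> ! c}"
      using bij by (auto simp: bij_betw_def inj_on_def)
    ultimately have "card {1..<\<tau> ! c} = card {b. b < k \<and> \<tau> ! b < \<tau> ! c}"
      by (metis card_image)
    with \<open>\<tau> ! c \<in> {1..k}\<close> show ?thesis by (cases "\<tau> ! c") auto
  qed
  show ?thesis
  proof
    assume o: "order_isomorphic u \<tau>"
    then have len: "length u = k" by (simp add: order_isomorphic_def k_def)
    have "{b. b < k \<and> u ! b < u ! c} = {b. b < k \<and> \<tau> ! b < \<tau> ! c}" if "c < k" for c
      using o that len unfolding order_isomorphic_def k_def by auto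
    then show "length u = length \<tau> \<and>
        (\<forall>c<length u. \<tau> ! c = Suc (card {b. b < length u \<and> u ! b < u ! c}))"
      using r len k_def by auto
  next
    assume o: "length u = length \<tau> \<and>
        (\<forall>c<length u. \<tau> ! c = Suc (card {b. b < length u \<and> u ! b < u ! c}))"
    define N where "N = {..<k}"
    have len: "length u = k" using o k_def by simp
    have rk: "\<tau> ! c = Suc (below_count ((!) u) N c)" if "c < k" for c
      using o that len unfolding below_count_def N_def by (simp add: conj_commute)
    have "\<tau> ! a < \<tau> ! b \<longleftrightarrow> u ! a < u ! b" if "a < k" "b < k" for a b
      using rank_less_iff[of N a b "(!) u"] rk that by (simp add: N_def)
    then show "order_isomorphic u \<tau>"
      using len k_def by (simp add: order_isomorphic_def)
  qed
qed

lemma subword_order_isomorphic_iff: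
  assumes "\<tau> \<in> perms (length \<tau>)" "finite I"
  shows "order_isomorphic (subword \<pi> I) \<tau> \<longleftrightarrow>
    card I = length \<tau> \<and> (\<forall>i\<in>I. \<tau> ! below_count id I i = Suc (below_count (entry \<pi>) I i))"
proof -
  let ?l = "sorted_list_of_set I"
  have len: "length ?l = card I" by simp
  have bij: "bij_betw ((!) ?l) {..<card I} I"
    using bij_betw_nth[of ?l "{..<card I}" I] assms(2) by simp
  have r: "card {b. b < card I \<and> entry \<pi> (?l ! b) < entry \<pi> (?l ! c)} = below_count (entry \<pi>) I (?l ! c)"
    if "c < card I" for c
  proof -
    have "(!) ?l ` {b \<in> {..<card I}. entry \<pi> (?l ! b) < entry \<pi> (?l ! c)} =
        {a \<in> I. entry \<pi> a < entry \<pi> (?l ! c)}"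
      using image_Collect_comp[of "(!) ?l" "{..<card I}" "\<lambda>a. entry \<pi> a < entry \<pi> (?l ! c)"]
      unfolding bij_betw_imp_surj_on[OF bij] .
    then have "{a \<in> I. entry \<pi> a < entry \<pi> (?l ! c)} =
        (!) ?l ` {b. b < card I \<and> entry \<pi> (?l ! b) < entry \<pi> (?l ! c)}" by simp
    moreover have "inj_on ((!) ?l) {b. b < card I \<and> entry \<pi> (?l ! b) < entry \<pi> (?l ! c)}"
      using bij by (auto simp: bij_betw_def inj_on_def)
    ultimately show ?thesis by (simp add: below_count_def card_image)
  qed
  have "(\<forall>i\<in>I. \<tau> ! below_count id I i = Suc (below_count (entry \<pi>) I i)) \<longleftrightarrow>
      (\<forall>c<card I. \<tau> ! below_count id I (?l ! c) = Suc (below_count (entry \<pi>) I (?l ! c)))"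
    using ball_image[of "(!) ?l" "card I" "\<lambda>i. \<tau> ! below_count id I i = Suc (below_count (entry \<pi>) I i)"]
    unfolding bij_betw_imp_surj_on[OF bij] .
  also have "\<dots> \<longleftrightarrow> (\<forall>c<card I. \<tau> ! c = Suc (card {b. b < card I \<and> entry \<pi> (?l ! b) < entry \<pi> (?l ! c)}))"
    using r rank_nth_sorted_list[OF assms(2)] by auto
  finally show ?thesis
    unfolding order_isomorphic_iff[OF assms(1)] subword_def
    by (auto simp: nth_map cong: conj_cong)
qed

lemma occurrences_iff:
  assumes "\<pi> \<in> perms n" "is_mesh_pattern p"
  shows "I \<in> occurrences p \<pi> \<longleftrightarrow> I \<subseteq> {1..n} \<and> card I = length (fst p) \<and>
    (\<forall>i\<in>I. fst p ! below_count id I i = Suc (below_count (entry \<pi>) I i)) \<and>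
    (\<forall>x\<in>{1..n} - I. (below_count id I x, below_count (entry \<pi>) I x) \<notin> snd p)"
proof (cases "I \<subseteq> {1..n} \<and> card I = length (fst p)")
  case True
  then have I: "I \<subseteq> {1..n}" "card I = length (fst p)" by auto
  have fin: "finite I" using I(1) finite_subset by blast
  have p: "fst p \<in> perms (length (fst p))" "snd p \<subseteq> {0..card I} \<times> {0..card I}"
    using assms(2) I by (auto simp: is_mesh_pattern_def)
  have "(\<forall>b\<in>snd p. mesh_box \<pi> I b = {}) \<longleftrightarrow>
      (\<forall>x\<in>{1..n} - I. (below_count id I x, below_count (entry \<pi>) I x) \<notin> snd p)"
  proof -
    have "mesh_box \<pi> I (r, s) = {x \<in> {1..n} - I. below_count id I x = r \<and> below_count (entry \<pi>) I x = s}"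
      if "(r, s) \<in> snd p" for r s
      using mem_mesh_box[OF assms(1) I(1), of r s] p(2) that by auto
    then show ?thesis by fastforce
  qed
  then show ?thesis
    using I subword_order_isomorphic_iff[OF p(1) fin, of \<pi>] entry_bij(2)[OF assms(1)]
    by (auto simp: occurrences_def)
next
  case False
  then show ?thesis
    using subword_order_isomorphic_iff[of "fst p" I \<pi>] assms(2) entry_bij(2)[OF assms(1)]
      finite_subset[of I "{1..n}"]
    by (auto simp: occurrences_def is_mesh_pattern_def)
qed


lemma standardize_subword:
  assumes "\<pi> \<in> perms n" "B \<subseteq> {1..n}"
  shows "standardize (subword \<pi> B) =
    map (\<lambda>i. Suc (below_count (entry \<pi>) B i)) (sorted_list_of_set B)"
proof -
  have fin: "finite B" using assms(2) finite_subset by blast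
  have inj: "inj_on (entry \<pi>) B" by (rule entry_inj[OF assms])
  have "card {y \<in> entry \<pi> ` B. y \<le> entry \<pi> i} = Suc (below_count (entry \<pi>) B i)" if "i \<in> B" for i
  proof -
    have "{y \<in> entry \<pi> ` B. y \<le> entry \<pi> i} = entry \<pi> ` {a \<in> B. entry \<pi> a \<le> entry \<pi> i}" by blast
    also have "{a \<in> B. entry \<pi> a \<le> entry \<pi> i} = insert i {a \<in> B. entry \<pi> a < entry \<pi> i}"
      using that inj by (auto simp: le_less dest: inj_onD)
    also have "card (entry \<pi> ` \<dots>) = card (insert i {a \<in> B. entry \<pi> a < entry \<pi> i})"
      by (rule card_image, rule inj_on_subset[OF inj]) (use that in auto)
    finally have "card {y \<in> entry \<pi> ` B. y \<le> entry \<pi> i} =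
        card (insert i {a \<in> B. entry \<pi> a < entry \<pi> i})" .
    then show ?thesis using fin by (simp add: below_count_def)
  qed
  then show ?thesis using fin by (simp add: standardize_def subword_def)
qed

lemma standardize_subword_facts:
  assumes "\<pi> \<in> perms n" "B \<subseteq> {1..n}"
  defines "f \<equiv> \<lambda>j. sorted_list_of_set B ! (j - 1)" and "\<rho> \<equiv> standardize (subword \<pi> B)"
  shows "\<rho> \<in> perms (card B)" "bij_betw f {1..card B} B"
    "\<And>a b. a \<in> {1..card B} \<Longrightarrow> b \<in> {1..card B} \<Longrightarrow> a < b \<longleftrightarrow> f a < f b"
    "\<And>a b. a \<in> {1..card B} \<Longrightarrow> b \<in> {1..card B} \<Longrightarrow>
       entry \<rho> a < entry \<rho> b \<longleftrightarrow> entry \<pi> (f a) < entry \<pi> (f b)"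
proof -
  let ?l = "sorted_list_of_set B"
  have fin: "finite B" using assms(2) finite_subset by blast
  have inj: "inj_on (entry \<pi>) B" by (rule entry_inj[OF assms(1,2)])
  have \<rho>: "\<rho> = map (\<lambda>i. Suc (below_count (entry \<pi>) B i)) ?l"
    unfolding \<rho>_def by (rule standardize_subword[OF assms(1,2)])
  have bij: "bij_betw (below_count (entry \<pi>) B) B {..<card B}" by (rule rank_bij[OF fin inj])
  have "set \<rho> = Suc ` (below_count (entry \<pi>) B ` B)" using fin by (simp add: \<rho> image_image)
  also have "\<dots> = {1..card B}"
    unfolding bij_betw_imp_surj_on[OF bij] by (simp add: image_Suc_lessThan)
  finally have set: "set \<rho> = {1..card B}" .
  moreover have "distinct \<rho>" by (rule card_distinct) (simp add: set, simp add: \<rho>)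
  ultimately show "\<rho> \<in> perms (card B)" by (rule permutations_of_setI)
  have "bij_betw ((!) ?l) {..<card B} B"
    using bij_betw_nth[of ?l "{..<card B}" B] fin by simp
  moreover have "bij_betw (\<lambda>j. j - 1) {1..card B} {..<card B}"
    by (rule bij_betw_byWitness[where f' = Suc]) auto
  ultimately have "bij_betw ((!) ?l \<circ> (\<lambda>j. j - 1)) {1..card B} B"
    by (rule bij_betw_trans[rotated])
  then show f: "bij_betw f {1..card B} B" by (simp add: f_def comp_def)
  fix a b assume ab: "a \<in> {1..card B}" "b \<in> {1..card B}"
  have rk: "below_count id B (f c) = c - 1" if "c \<in> {1..card B}" for c
    unfolding f_def by (rule rank_nth_sorted_list[OF fin]) (use that in auto)
  have mem: "f c \<in> B" if "c \<in> {1..card B}" for c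
    using f that by (auto simp: bij_betw_def)
  show "a < b \<longleftrightarrow> f a < f b"
    using rank_less_iff[OF fin mem[OF ab(1)] mem[OF ab(2)], of id] rk[OF ab(1)] rk[OF ab(2)] ab
    by auto
  have "entry \<rho> c = Suc (below_count (entry \<pi>) B (f c))" if "c \<in> {1..card B}" for c
    using that fin by (auto simp: \<rho> f_def entry_def)
  then show "entry \<rho> a < entry \<rho> b \<longleftrightarrow> entry \<pi> (f a) < entry \<pi> (f b)"
    using ab rank_less_iff[OF fin mem[OF ab(1)] mem[OF ab(2)], of "entry \<pi>"] by simp
qed

lemma occurrences_standardize_iff:
  assumes "\<pi> \<in> perms n" "B \<subseteq> {1..n}" "is_mesh_pattern p" "J \<subseteq> {1..card B}"
  defines "f \<equiv> \<lambda>j. sorted_list_of_set B ! (j - 1)"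
  shows "J \<in> occurrences p (standardize (subword \<pi> B)) \<longleftrightarrow>
    card (f ` J) = length (fst p) \<and>
    (\<forall>j\<in>f ` J. fst p ! below_count id (f ` J) j = Suc (below_count (entry \<pi>) (f ` J) j)) \<and>
    (\<forall>x\<in>B - f ` J. (below_count id (f ` J) x, below_count (entry \<pi>) (f ` J) x) \<notin> snd p)"
proof -
  let ?\<rho> = "standardize (subword \<pi> B)"
  note st = standardize_subword_facts[OF assms(1,2), folded f_def]
  have injf: "inj_on f {1..card B}" using st(2) by (simp add: bij_betw_def)
  then have injJ: "inj_on f J" using assms(4) by (rule inj_on_subset)
  have lt: "a < b \<longleftrightarrow> f a < f b"
    and lt': "entry ?\<rho> a < entry ?\<rho> b \<longleftrightarrow> entry \<pi> (f a) < entry \<pi> (f b)"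
    if "a \<in> {1..card B}" "b \<in> {1..card B}" for a b
    using st(3,4)[OF that] by (simp_all only: f_def)
  have c: "below_count id (f ` J) (f x) = below_count id J x" if "x \<in> {1..card B}" for x
  proof (rule rank_image[OF _ injJ])
    show "id a < id x \<longleftrightarrow> id (f a) < id (f x)" if "a \<in> J" for a
      using lt[of a x] that assms(4) \<open>x \<in> {1..card B}\<close> by (simp only: id_apply) blast
  qed
  have r: "below_count (entry \<pi>) (f ` J) (f x) = below_count (entry ?\<rho>) J x" if "x \<in> {1..card B}" for x
  proof (rule rank_image[OF _ injJ])
    show "entry ?\<rho> a < entry ?\<rho> x \<longleftrightarrow> entry \<pi> (f a) < entry \<pi> (f x)" if "a \<in> J" for a
      using lt'[of a x] that assms(4) \<open>x \<in> {1..card B}\<close> by blast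
  qed
  have "B - f ` J = f ` {1..card B} - f ` J" using st(2) by (simp add: bij_betw_def)
  also have "\<dots> = f ` ({1..card B} - J)"
    using inj_on_image_set_diff[OF injf _ assms(4)] by simp
  finally have B: "B - f ` J = f ` ({1..card B} - J)" .
  have "(\<forall>j\<in>f ` J. fst p ! below_count id (f ` J) j = Suc (below_count (entry \<pi>) (f ` J) j)) \<longleftrightarrow>
      (\<forall>j\<in>J. fst p ! below_count id J j = Suc (below_count (entry ?\<rho>) J j))"
    using c r assms(4) by (auto simp: subset_iff simp del: atLeastAtMost_iff)
  moreover have "(\<forall>x\<in>B - f ` J. (below_count id (f ` J) x, below_count (entry \<pi>) (f ` J) x) \<notin> snd p) \<longleftrightarrow>
      (\<forall>x\<in>{1..card B} - J. (below_count id J x, below_count (entry ?\<rho>) J x) \<notin> snd p)"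
    unfolding B using c r by (auto simp del: atLeastAtMost_iff)
  ultimately show ?thesis
    using occurrences_iff[OF st(1) assms(3), of J] card_image[OF injJ] assms(4) by simp
qed

definition push :: "nat \<Rightarrow> nat \<Rightarrow> nat \<Rightarrow> nat" where
  "push s k v = (if v \<le> s then v else v + k)"

lemma push_inject: "push s k v = push s k v' \<longleftrightarrow> v = v'"
  by (auto simp: push_def)

lemma mesh_insert_word:
  "fst (mesh_insert base (r, s) p) = map (push s (length (fst p))) (take r (fst base)) @
     map (\<lambda>v. s + v) (fst p) @ map (push s (length (fst p))) (drop r (fst base))"
  by (simp add: mesh_insert_def Let_def push_def)

lemma mesh_insert_length:
  "length (fst (mesh_insert base (r, s) p)) = length (fst base) + length (fst p)"
  by (simp add: mesh_insert_word)

lemma mesh_insert_nth_base: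
  assumes "r \<le> length (fst base)" "c < length (fst base)"
  shows "fst (mesh_insert base (r, s) p) ! (if c < r then c else c + length (fst p)) =
    push s (length (fst p)) (fst base ! c)"
  using assms by (auto simp: mesh_insert_word nth_append)

lemma mesh_insert_nth_inserted:
  assumes "r \<le> length (fst base)" "c < length (fst p)"
  shows "fst (mesh_insert base (r, s) p) ! (r + c) = s + fst p ! c"
  using assms by (auto simp: mesh_insert_word nth_append)

lemma mesh_insert_shading:
  "snd (mesh_insert base (r, s) p) =
     {(c, d). c \<le> length (fst base) + length (fst p) \<and> d \<le> length (fst base) + length (fst p) \<and>
       (unsplit r (length (fst p)) c, unsplit s (length (fst p)) d) \<in> snd base} \<union>
     (\<lambda>(c, d). (r + c, s + d)) ` snd p"
  by (simp add: mesh_insert_def Let_def)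

lemma is_mesh_pattern_mesh_insert:
  assumes "is_mesh_pattern base" "is_mesh_pattern p" "r \<le> length (fst base)" "s \<le> length (fst base)"
  shows "is_mesh_pattern (mesh_insert base (r, s) p)"
proof -
  define m k where "m = length (fst base)" and "k = length (fst p)"
  let ?w = "fst (mesh_insert base (r, s) p)"
  have b: "set (fst base) = {1..m}" and p: "set (fst p) = {1..k}" "snd p \<subseteq> {0..k} \<times> {0..k}"
    using assms(1,2) by (auto simp: is_mesh_pattern_def m_def k_def dest: permutations_of_setD)
  have "set ?w = push s k ` (set (take r (fst base)) \<union> set (drop r (fst base))) \<union> (\<lambda>v. s + v) ` {1..k}"
    unfolding mesh_insert_word k_def[symmetric] by (auto simp: p(1))
  also have "set (take r (fst base)) \<union> set (drop r (fst base)) = {1..m}"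
    unfolding b[symmetric] by (metis append_take_drop_id set_append)
  also have "push s k ` {1..m} \<union> (\<lambda>v. s + v) ` {1..k} = {1..m + k}"
  proof
    show "push s k ` {1..m} \<union> (\<lambda>v. s + v) ` {1..k} \<subseteq> {1..m + k}"
      using assms(4) by (auto simp: push_def m_def)
    show "{1..m + k} \<subseteq> push s k ` {1..m} \<union> (\<lambda>v. s + v) ` {1..k}"
    proof
      fix v assume v: "v \<in> {1..m + k}"
      consider "v \<le> s" | "s < v" "v \<le> s + k" | "s + k < v" by linarith
      then show "v \<in> push s k ` {1..m} \<union> (\<lambda>v. s + v) ` {1..k}"
      proof cases
        case 1
        then have "v = push s k v" "v \<in> {1..m}" using v assms(4) by (auto simp: push_def m_def)
        then show ?thesis by blast
      next
        case 2
        then have "v = s + (v - s)" "v - s \<in> {1..k}" by auto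
        then show ?thesis by blast
      next
        case 3
        then have "v = push s k (v - k)" "v - k \<in> {1..m}" using v by (auto simp: push_def)
        then show ?thesis by blast
      qed
    qed
  qed
  finally have w: "set ?w = {1..m + k}" .
  have len: "length ?w = m + k" by (simp add: mesh_insert_length m_def k_def)
  have "distinct ?w" by (rule card_distinct) (simp add: w len)
  then have "?w \<in> perms (length ?w)" using w len by (simp add: permutations_of_setI)
  moreover have "snd (mesh_insert base (r, s) p) \<subseteq> {0..length ?w} \<times> {0..length ?w}"
    using p(2) assms(3,4)
    unfolding len mesh_insert_shading m_def[symmetric] k_def[symmetric] by fastforce
  ultimately show ?thesis by (simp add: is_mesh_pattern_def)
qed

lemma occurrences_mesh_insert_Un:
  assumes \<pi>: "\<pi> \<in> perms n" and base: "is_mesh_pattern base" and p: "is_mesh_pattern p"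
    and rs: "r \<le> length (fst base)" "s \<le> length (fst base)" "(r, s) \<notin> snd base"
    and I: "I \<subseteq> {1..n}" "card I = length (fst base)"
    and J: "J \<subseteq> {1..n} - I" "card J = length (fst p)"
      "\<And>j. j \<in> J \<Longrightarrow> below_count id I j = r" "\<And>j. j \<in> J \<Longrightarrow> below_count (entry \<pi>) I j = s"
  shows "I \<union> J \<in> occurrences (mesh_insert base (r, s) p) \<pi> \<longleftrightarrow> I \<in> occurrences base \<pi> \<and>
    (\<forall>j\<in>J. fst p ! below_count id J j = Suc (below_count (entry \<pi>) J j)) \<and>
    (\<forall>x\<in>{1..n} - (I \<union> J). below_count id I x = r \<longrightarrow> below_count (entry \<pi>) I x = s \<longrightarrow>
       (below_count id J x, below_count (entry \<pi>) J x) \<notin> snd p)"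
proof -
  let ?w = "fst (mesh_insert base (r, s) p)" and ?S = "snd (mesh_insert base (r, s) p)"
  let ?e = "entry \<pi>"
  have fin: "finite I" "finite J" using I J by (auto intro: finite_subset)
  have disj: "I \<inter> J = {}" and sub: "I \<union> J \<subseteq> {1..n}" using I J by auto
  have inj: "inj_on id (I \<union> J)" "inj_on ?e (I \<union> J)" using entry_inj[OF \<pi> sub] by auto
  note un = rank_union[OF fin disj]
  have cardU: "card (I \<union> J) = length ?w"
    using fin disj I J by (simp add: card_Un_disjoint mesh_insert_length)
  note mc = rank_union_mem[OF fin disj J(3) inj(1)] and mr = rank_union_mem[OF fin disj J(4) inj(2)]
  have wI: "?w ! below_count id (I \<union> J) i = Suc (below_count ?e (I \<union> J) i) \<longleftrightarrow>
      fst base ! below_count id I i = Suc (below_count ?e I i)" if "i \<in> I" for i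
  proof -
    have "below_count id I i < length (fst base)" using rank_less_card[OF fin(1) that, of id] I by simp
    then have "?w ! below_count id (I \<union> J) i = push s (length (fst p)) (fst base ! below_count id I i)"
      using mesh_insert_nth_base[OF rs(1), of "below_count id I i" s p] unfolding mc[OF _ that, simplified] J(2) by simp
    moreover have "Suc (below_count ?e (I \<union> J) i) = push s (length (fst p)) (Suc (below_count ?e I i))"
      using mr[OF _ that] J(2) by (simp add: push_def)
    ultimately show ?thesis by (simp add: push_inject)
  qed
  have wJ: "?w ! below_count id (I \<union> J) j = Suc (below_count ?e (I \<union> J) j) \<longleftrightarrow>
      fst p ! below_count id J j = Suc (below_count ?e J j)" if "j \<in> J" for j
    using mesh_insert_nth_inserted[OF rs(1), of "below_count id J j" p s] J(2) J(3,4)[OF that]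
      rank_less_card[OF fin(2) that, of id] un by simp
  have S: "(below_count id (I \<union> J) x, below_count ?e (I \<union> J) x) \<in> ?S \<longleftrightarrow>
      (below_count id I x, below_count ?e I x) \<in> snd base \<or>
      below_count id I x = r \<and> below_count ?e I x = s \<and> (below_count id J x, below_count ?e J x) \<in> snd p" for x
  proof -
    have le: "below_count id (I \<union> J) x \<le> length (fst base) + length (fst p)"
      "below_count ?e (I \<union> J) x \<le> length (fst base) + length (fst p)"
      using rank_le_card[of "I \<union> J" _ x] fin cardU by (simp_all add: mesh_insert_length)
    have "(below_count id (I \<union> J) x, below_count ?e (I \<union> J) x) \<in> (\<lambda>(c, d). (r + c, s + d)) ` snd p \<longleftrightarrow>
        (\<exists>(c, d)\<in>snd p. below_count id (I \<union> J) x = r + c \<and> below_count ?e (I \<union> J) x = s + d)"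
      by force
    also have "\<dots> \<longleftrightarrow> (\<exists>(c, d)\<in>snd p. (below_count id I x = r \<and> below_count id J x = c) \<and>
        (below_count ?e I x = s \<and> below_count ?e J x = d))"
    proof (rule bex_cong[OF refl], clarify)
      fix c d assume "(c, d) \<in> snd p"
      then have cd: "c \<le> card J" "d \<le> card J" using p J(2) by (auto simp: is_mesh_pattern_def)
      show "(below_count id (I \<union> J) x = r + c \<and> below_count ?e (I \<union> J) x = s + d) =
        ((below_count id I x = r \<and> below_count id J x = c) \<and> below_count ?e I x = s \<and> below_count ?e J x = d)"
        using rank_middle[OF fin disj J(3) cd(1), of x] rank_middle[OF fin disj J(4) cd(2), of x]
        by simp
    qed
    finally show ?thesis
      unfolding mesh_insert_shading
      using le unsplit_rank[OF fin disj J(3), of x] unsplit_rank[OF fin disj J(4), of x] J(2) by auto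
  qed
  have base_iff: "(\<forall>x\<in>{1..n} - I. (below_count id I x, below_count ?e I x) \<notin> snd base) \<longleftrightarrow>
      (\<forall>x\<in>{1..n} - (I \<union> J). (below_count id I x, below_count ?e I x) \<notin> snd base)"
    using J(3,4) rs(3) by blast
  show ?thesis
    unfolding occurrences_iff[OF \<pi> is_mesh_pattern_mesh_insert[OF base p rs(1,2)]]
      occurrences_iff[OF \<pi> base] S base_iff
    using sub cardU I wI wJ by (auto simp del: atLeastAtMost_iff)
qed

lemma rank_union_outer:
  assumes "finite I" "finite J" "I \<inter> J = {}" "\<And>j. j \<in> J \<Longrightarrow> below_count id I j = r"
  shows "{i \<in> I \<union> J. below_count id (I \<union> J) i < r \<or> r + card J \<le> below_count id (I \<union> J) i} = I"
proof -
  have "below_count id (I \<union> J) i < r \<or> r + card J \<le> below_count id (I \<union> J) i" if "i \<in> I" for i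
    using rank_union_mem[OF assms, of i] that by auto
  moreover have "\<not> (below_count id (I \<union> J) j < r \<or> r + card J \<le> below_count id (I \<union> J) j)" if "j \<in> J" for j
    using rank_union[OF assms(1-3), of id j] assms(4)[OF that] rank_less_card[OF assms(2) that, of id]
    by simp
  ultimately show ?thesis by blast
qed

lemma occurrences_mesh_insert_decompose:
  assumes \<pi>: "\<pi> \<in> perms n" and base: "is_mesh_pattern base" and p: "is_mesh_pattern p"
    and rs: "r \<le> length (fst base)" "s \<le> length (fst base)"
    and K: "K \<in> occurrences (mesh_insert base (r, s) p) \<pi>"
  obtains I J where "K = I \<union> J" "I \<subseteq> {1..n}" "card I = length (fst base)"
    "J \<subseteq> {1..n} - I" "card J = length (fst p)"
    "\<And>j. j \<in> J \<Longrightarrow> below_count id I j = r" "\<And>j. j \<in> J \<Longrightarrow> below_count (entry \<pi>) I j = s"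
proof -
  let ?w = "fst (mesh_insert base (r, s) p)" and ?e = "entry \<pi>"
  define m k where "m = length (fst base)" and "k = length (fst p)"
  have K: "K \<subseteq> {1..n}" "card K = m + k" "\<And>i. i \<in> K \<Longrightarrow> ?w ! below_count id K i = Suc (below_count ?e K i)"
    using K occurrences_iff[OF \<pi> is_mesh_pattern_mesh_insert[OF base p rs], of K]
    by (auto simp: mesh_insert_length m_def k_def)
  have fin: "finite K" using K(1) finite_subset by blast
  have inj: "inj_on id K" "inj_on ?e K" using entry_inj[OF \<pi> K(1)] by auto
  define I where "I = {i \<in> K. below_count id K i < r \<or> r + k \<le> below_count id K i}"
  define J where "J = {i \<in> K. below_count id K i \<in> {r..<r + k}}"
  have KIJ: "K = I \<union> J" "I \<inter> J = {}" by (auto simp: I_def J_def)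
  have "card J = card {r..<r + k}"
    unfolding J_def by (rule card_rank_vimage[OF fin inj(1)]) (use rs K(2) m_def in auto)
  then have cJ: "card J = k" by simp
  have "card K = card I + card J"
    using fin KIJ by (metis card_Un_disjoint finite_Un)
  then have cI: "card I = m" using cJ K(2) by simp
  have rows: "(below_count id K i < r \<or> r + k \<le> below_count id K i) \<longleftrightarrow> (below_count ?e K i < s \<or> s + k \<le> below_count ?e K i)"
    if "i \<in> K" for i
  proof -
    let ?c = "below_count id K i"
    have lt: "?c < m + k" using rank_less_card[OF fin that, of id] K(2) by simp
    have out: "Suc (below_count ?e K i) = push s k (fst base ! c)"
      if "c < m" "?c = (if c < r then c else c + k)" for c
      using mesh_insert_nth_base[OF rs(1), of c s p] K(3)[OF \<open>i \<in> K\<close>] that(1)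
      unfolding that(2) k_def[symmetric] m_def[symmetric] by simp
    consider "?c < r" | "r \<le> ?c" "?c < r + k" | "r + k \<le> ?c" by linarith
    then show ?thesis
    proof cases
      case 1
      then have "Suc (below_count ?e K i) = push s k (fst base ! ?c)" using out[of ?c] rs by (simp add: m_def)
      then show ?thesis using 1 by (auto simp: push_def split: if_splits)
    next
      case 2
      have c: "?c - r < length (fst p)" using 2 by (simp add: k_def)
      then have "fst p ! (?c - r) \<in> set (fst p)" by simp
      also have "set (fst p) = {1..k}"
        using p by (auto simp: is_mesh_pattern_def k_def dest: permutations_of_setD)
      finally have "fst p ! (?c - r) \<in> {1..k}" .
      moreover have "Suc (below_count ?e K i) = s + fst p ! (?c - r)"
        using mesh_insert_nth_inserted[OF rs(1) c, of s] K(3)[OF that] 2 by simp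
      ultimately show ?thesis using 2 by auto
    next
      case 3
      then have "Suc (below_count ?e K i) = push s k (fst base ! (?c - k))" using out[of "?c - k"] lt by auto
      then show ?thesis using 3 by (auto simp: push_def split: if_splits)
    qed
  qed
  have Ir: "I = {i \<in> K. below_count ?e K i < s \<or> s + k \<le> below_count ?e K i}"
    unfolding I_def using rows by blast
  show ?thesis
  proof
    show "K = I \<union> J" "card I = length (fst base)" "card J = length (fst p)"
      using KIJ cI cJ by (auto simp: m_def k_def)
    show "I \<subseteq> {1..n}" "J \<subseteq> {1..n} - I" using KIJ K(1) by auto
    fix j assume j: "j \<in> J"
    then have jK: "j \<in> K" using KIJ by auto
    show "below_count id I j = r"
      unfolding I_def
      by (rule rank_outer[OF fin inj(1) _ jK]) (use j rs K(2) in \<open>auto simp: J_def m_def\<close>)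
    have "\<not> (below_count ?e K j < s \<or> s + k \<le> below_count ?e K j)"
      using rows[OF jK] j by (auto simp: J_def)
    then show "below_count ?e I j = s"
      unfolding Ir
      by (intro rank_outer[OF fin inj(2) _ jK]) (use rs K(2) in \<open>auto simp: m_def\<close>)
  qed
qed

lemma occurrences_mesh_insert:
  assumes \<pi>: "\<pi> \<in> perms n" and base: "is_mesh_pattern base" and p: "is_mesh_pattern p"
    and rs: "r \<le> length (fst base)" "s \<le> length (fst base)" "(r, s) \<notin> snd base"
  shows "bij_betw (\<lambda>(I, J). I \<union> box_position \<pi> I (r, s) ` J)
    (SIGMA I:occurrences base \<pi>. occurrences p (box_perm \<pi> I (r, s)))
    (occurrences (mesh_insert base (r, s) p) \<pi>)"
proof -
  let ?e = "entry \<pi>"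
  let ?B = "\<lambda>I. mesh_box \<pi> I (r, s)" and ?f = "\<lambda>I. box_position \<pi> I (r, s)"
  have f: "?f I = (\<lambda>j. sorted_list_of_set (?B I) ! (j - 1))" for I
    by (auto simp: box_position_def)
  have box: "?B I = {x \<in> {1..n} - I. below_count id I x = r \<and> below_count ?e I x = s}"
    if "I \<subseteq> {1..n}" "card I = length (fst base)" for I
    using mem_mesh_box[OF \<pi> that(1), of r s] that(2) rs by auto
  have Bsub: "?B I \<subseteq> {1..n}" for I
    using entry_bij(2)[OF \<pi>] by (auto simp: mesh_box_def)
  note st = standardize_subword_facts(1,2)[OF \<pi> Bsub, folded f]
  have occ_sub: "J \<subseteq> {1..card (?B I)}" if "J \<in> occurrences p (box_perm \<pi> I (r, s))" for I J
    using that occurrences_iff[OF st(1) p] by (simp add: box_perm_def)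
  have occ_box: "J \<in> occurrences p (box_perm \<pi> I (r, s)) \<longleftrightarrow>
      card (?f I ` J) = length (fst p) \<and>
      (\<forall>j\<in>?f I ` J. fst p ! below_count id (?f I ` J) j = Suc (below_count ?e (?f I ` J) j)) \<and>
      (\<forall>x\<in>?B I - ?f I ` J. (below_count id (?f I ` J) x, below_count ?e (?f I ` J) x) \<notin> snd p)"
    if "J \<subseteq> {1..card (?B I)}" for I J
    unfolding box_perm_def f by (rule occurrences_standardize_iff[OF \<pi> Bsub p that])
  have occ_base: "I \<subseteq> {1..n} \<and> card I = length (fst base)" if "I \<in> occurrences base \<pi>" for I
    using that occurrences_iff[OF \<pi> base] by simp
  have key: "I \<union> ?f I ` J \<in> occurrences (mesh_insert base (r, s) p) \<pi> \<longleftrightarrow>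
      I \<in> occurrences base \<pi> \<and> J \<in> occurrences p (box_perm \<pi> I (r, s))"
    if "I \<subseteq> {1..n}" "card I = length (fst base)" "J \<subseteq> {1..card (?B I)}"
       "card (?f I ` J) = length (fst p)" for I J
  proof -
    have sub: "?f I ` J \<subseteq> ?B I" using st(2)[of I] that(3) by (auto simp: bij_betw_def)
    have "I \<union> ?f I ` J \<in> occurrences (mesh_insert base (r, s) p) \<pi> \<longleftrightarrow> I \<in> occurrences base \<pi> \<and>
      (\<forall>j\<in>?f I ` J. fst p ! below_count id (?f I ` J) j = Suc (below_count ?e (?f I ` J) j)) \<and>
      (\<forall>x\<in>{1..n} - (I \<union> ?f I ` J). below_count id I x = r \<longrightarrow> below_count ?e I x = s \<longrightarrow>
         (below_count id (?f I ` J) x, below_count ?e (?f I ` J) x) \<notin> snd p)"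
      by (rule occurrences_mesh_insert_Un[OF \<pi> base p rs that(1,2) _ that(4)])
         (use sub box[OF that(1,2)] in auto)
    also have "(\<forall>x\<in>{1..n} - (I \<union> ?f I ` J). below_count id I x = r \<longrightarrow> below_count ?e I x = s \<longrightarrow>
         (below_count id (?f I ` J) x, below_count ?e (?f I ` J) x) \<notin> snd p) \<longleftrightarrow>
       (\<forall>x\<in>?B I - ?f I ` J. (below_count id (?f I ` J) x, below_count ?e (?f I ` J) x) \<notin> snd p)"
      unfolding box[OF that(1,2)] by blast
    finally show ?thesis unfolding occ_box[OF that(3)] using that(4) by blast
  qed
  have occ_pair: "I \<subseteq> {1..n}" "card I = length (fst base)" "J \<subseteq> {1..card (?B I)}"
      "card (?f I ` J) = length (fst p)" "?f I ` J \<subseteq> ?B I"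
    if "I \<in> occurrences base \<pi>" "J \<in> occurrences p (box_perm \<pi> I (r, s))" for I J
  proof -
    show J: "J \<subseteq> {1..card (?B I)}" by (rule occ_sub[OF that(2)])
    show "I \<subseteq> {1..n}" "card I = length (fst base)" using occ_base[OF that(1)] by auto
    show "card (?f I ` J) = length (fst p)" using occ_box[OF J] that(2) by simp
    show "?f I ` J \<subseteq> ?B I" using st(2)[of I] J by (auto simp: bij_betw_def)
  qed
  have outer: "{i \<in> I \<union> ?f I ` J. below_count id (I \<union> ?f I ` J) i < r \<or>
      r + length (fst p) \<le> below_count id (I \<union> ?f I ` J) i} = I" "?f I ` J = (I \<union> ?f I ` J) - I"
    if "I \<in> occurrences base \<pi>" "J \<in> occurrences p (box_perm \<pi> I (r, s))" for I J
  proof -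
    note o = occ_pair[OF that]
    have d: "finite I" "finite (?f I ` J)" "I \<inter> ?f I ` J = {}"
      using o(5) box[OF o(1,2)] o(1,3) by (auto intro: finite_subset[of I "{1..n}"] finite_subset)
    show "{i \<in> I \<union> ?f I ` J. below_count id (I \<union> ?f I ` J) i < r \<or>
      r + length (fst p) \<le> below_count id (I \<union> ?f I ` J) i} = I"
      unfolding o(4)[symmetric]
      by (rule rank_union_outer[OF d]) (use o(5) box[OF o(1,2)] in auto)
    show "?f I ` J = (I \<union> ?f I ` J) - I" using d(3) by blast
  qed
  show ?thesis
  proof (rule bij_betw_imageI)
    show "inj_on (\<lambda>(I, J). I \<union> ?f I ` J) (SIGMA I:occurrences base \<pi>. occurrences p (box_perm \<pi> I (r, s)))"
    proof (rule inj_onI, clarify)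
      fix I J I' J'
      assume o: "I \<in> occurrences base \<pi>" "J \<in> occurrences p (box_perm \<pi> I (r, s))"
        and o': "I' \<in> occurrences base \<pi>" "J' \<in> occurrences p (box_perm \<pi> I' (r, s))"
        and eq: "I \<union> ?f I ` J = I' \<union> ?f I' ` J'"
      have II: "I = I'"
        using outer(1)[OF o] outer(1)[OF o'] unfolding eq by simp
      have "?f I ` J = ?f I ` J'"
        using outer(2)[OF o] outer(2)[OF o'] eq unfolding II by simp
      moreover have "inj_on (?f I) {1..card (?B I)}" using st(2)[of I] by (simp add: bij_betw_def)
      ultimately have "J = J'"
        using occ_pair(3)[OF o] occ_pair(3)[OF o'] inj_on_image_eq_iff unfolding II by metis
      with II show "I = I' \<and> J = J'" by simp
    qed
    show "(\<lambda>(I, J). I \<union> ?f I ` J) ` (SIGMA I:occurrences base \<pi>. occurrences p (box_perm \<pi> I (r, s))) =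
      occurrences (mesh_insert base (r, s) p) \<pi>"
    proof (intro equalityI subsetI)
      fix K assume "K \<in> (\<lambda>(I, J). I \<union> ?f I ` J) `
        (SIGMA I:occurrences base \<pi>. occurrences p (box_perm \<pi> I (r, s)))"
      then show "K \<in> occurrences (mesh_insert base (r, s) p) \<pi>"
        using key occ_pair by auto
    next
      fix K assume K: "K \<in> occurrences (mesh_insert base (r, s) p) \<pi>"
      obtain I J where IJ: "K = I \<union> J" "I \<subseteq> {1..n}" "card I = length (fst base)"
        "J \<subseteq> {1..n} - I" "card J = length (fst p)"
        "\<And>j. j \<in> J \<Longrightarrow> below_count id I j = r" "\<And>j. j \<in> J \<Longrightarrow> below_count ?e I j = s"
        using occurrences_mesh_insert_decompose[OF \<pi> base p rs(1,2) K] by metis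
      have "J \<subseteq> ?B I" using IJ(4,6,7) box[OF IJ(2,3)] by blast
      then obtain J' where J': "J' \<subseteq> {1..card (?B I)}" "J = ?f I ` J'"
        using st(2)[of I] by (metis bij_betw_imp_surj_on subset_imageE)
      then have "I \<in> occurrences base \<pi>" "J' \<in> occurrences p (box_perm \<pi> I (r, s))"
        using key[OF IJ(2,3) J'(1)] IJ(1,5) K by auto
      then show "K \<in> (\<lambda>(I, J). I \<union> ?f I ` J) `
        (SIGMA I:occurrences base \<pi>. occurrences p (box_perm \<pi> I (r, s)))"
        using IJ(1) J'(2) by force
    qed
  qed
qed

end

theory Submission
  imports Defs
begin

text \<open>
  The shading of the base pattern forces an occurrence \<open>a \<dots> b\<close> of it in \<open>\<pi>\<close> to look as follows:
  everything to its left is larger than \<open>b\<close>, everything between its two elements has a value between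
  \<open>a\<close> and \<open>b\<close>, and everything to its right is smaller than \<open>a\<close>. Writing \<open>\<ominus>\<close> for the skew sum, the
  occurrences in \<open>\<pi>\<close> thus correspond to the decompositions \<open>\<pi> = \<sigma> \<ominus> \<beta>(\<mu>) \<ominus> \<rho>\<close>, where \<open>\<beta>(\<mu>)\<close> is the
  permutation \<open>\<mu>\<close> of the box \<open>(1, 1)\<close> with a new minimum in front and a new maximum at the end
  (\<open>bij_betw_frames_occurrences\<close>). By \<open>occurrences_mesh_insert\<close>, \<open>p(\<pi>)\<close> is the sum of \<open>p\<^sub>1(\<mu>)\<close> over
  these decompositions (\<open>occ_count_mesh_insert\<close>).

  Two occurrences of the base pattern never overlap or interleave. They are therefore linearly
  ordered from left to right, and those to the right of a given one are exactly the occurrences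
  inside its \<open>\<rho>\<close> (\<open>frames_of_rest\<close>). Now \<open>q ^ p(\<pi>)\<close> is the product of the weights
  \<open>w\<^sub>i = q ^ p\<^sub>1(\<mu>\<^sub>i)\<close> over the occurrences, and the telescoping identity
  \<open>1 - \<Prod>\<^sub>i w\<^sub>i = \<Sum>\<^sub>i (1 - w\<^sub>i) \<Prod>\<^sub>j\<^sub>>\<^sub>i w\<^sub>j\<close> turns \<open>1 - q ^ p(\<pi>)\<close> into the sum of
  \<open>(1 - q ^ p\<^sub>1(\<mu>)) q ^ p(\<rho>)\<close> over the decompositions of \<open>\<pi>\<close>. Summed over all \<open>\<pi>\<close>, the triple
  \<open>(\<sigma>, \<mu>, \<rho>)\<close> becomes arbitrary, and as \<open>\<beta>(\<mu>)\<close> has two elements more than \<open>\<mu>\<close>,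
  \<open>F - F\<^sub>p = x\<^sup>2 F (F - F\<^sub>p\<^sub>1) F\<^sub>p\<close>, which is the claim after solving for \<open>F\<^sub>p\<close>.

  This argument is valid for every \<open>q\<close> in a commutative ring (\<open>occ_gf_mesh_insert\<close>). The series in two
  variables is the case where \<open>q\<close> is an indeterminate, and the one counting avoiders is the case
  \<open>q = 0\<close>, since \<open>0 ^ 0 = 1\<close>.
\<close>

section \<open>Permutations of all sizes and skew sums\<close>

text \<open>
  One-line notations of permutations of any size; the equation entails distinctness, because the list
  has as many different letters as its length.
\<close>

definition all_perms :: "nat list set" where
  "all_perms = {\<pi>. set \<pi> = {1..length \<pi>}}"

lemma all_perms_distinct: "\<pi> \<in> all_perms \<Longrightarrow> distinct \<pi>"
  by (rule card_distinct) (simp add: all_perms_def)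

lemma perms_eq_all_perms: "perms n = {\<pi> \<in> all_perms. length \<pi> = n}"
proof (intro equalityI subsetI)
  fix \<pi> assume "\<pi> \<in> perms n"
  then show "\<pi> \<in> {\<pi> \<in> all_perms. length \<pi> = n}"
    using entry_bij(2)[of \<pi> n] by (auto simp: all_perms_def dest: permutations_of_setD)
next
  fix \<pi> assume "\<pi> \<in> {\<pi> \<in> all_perms. length \<pi> = n}"
  then show "\<pi> \<in> perms n"
    using all_perms_distinct[of \<pi>] by (auto simp: all_perms_def intro!: permutations_of_setI)
qed

lemma finite_all_perms_length: "finite {\<pi> \<in> all_perms. length \<pi> = n}"
  unfolding perms_eq_all_perms[symmetric] by simp

definition skew_sum :: "nat list \<Rightarrow> nat list \<Rightarrow> nat list" where
  "skew_sum \<alpha> \<beta> = map (\<lambda>v. v + length \<beta>) \<alpha> @ \<beta>"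

lemma length_skew_sum [simp]: "length (skew_sum \<alpha> \<beta>) = length \<alpha> + length \<beta>"
  by (simp add: skew_sum_def)

lemma skew_sum_assoc: "skew_sum (skew_sum \<alpha> \<beta>) \<gamma> = skew_sum \<alpha> (skew_sum \<beta> \<gamma>)"
  by (simp add: skew_sum_def comp_def add_ac)

lemma image_add_atLeastAtMost_1: "(\<lambda>v. v + k) ` {1..m} = {k + 1..k + m}" for k m :: nat
  by (metis add.commute image_add_atLeastAtMost')

lemma skew_sum_inject:
  assumes "length \<beta> = length \<beta>'"
  shows "skew_sum \<alpha> \<beta> = skew_sum \<alpha>' \<beta>' \<longleftrightarrow> \<alpha> = \<alpha>' \<and> \<beta> = \<beta>'"
  using assms by (auto simp: skew_sum_def inj_def dest: map_injective)

lemma skew_sum_in_all_perms_iff: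
  assumes "\<beta> \<in> all_perms"
  shows "skew_sum \<alpha> \<beta> \<in> all_perms \<longleftrightarrow> \<alpha> \<in> all_perms"
proof -
  define k m where "k = length \<beta>" and "m = length \<alpha>"
  have \<beta>: "set \<beta> = {1..k}" using assms by (simp add: all_perms_def k_def)
  show ?thesis
  proof
    assume "\<alpha> \<in> all_perms"
    then have "set \<alpha> = {1..m}" by (simp add: all_perms_def m_def)
    then have "set (skew_sum \<alpha> \<beta>) = {k + 1..k + m} \<union> {1..k}"
      unfolding skew_sum_def set_append set_map k_def[symmetric] \<beta> image_add_atLeastAtMost_1[symmetric]
      by simp
    also have "\<dots> = {1..m + k}" by auto
    finally show "skew_sum \<alpha> \<beta> \<in> all_perms" by (simp add: all_perms_def k_def m_def)
  next
    assume s: "skew_sum \<alpha> \<beta> \<in> all_perms"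
    then have "set (skew_sum \<alpha> \<beta>) = {1..m + k}" by (simp add: all_perms_def k_def m_def)
    then have U: "(\<lambda>v. v + k) ` set \<alpha> \<union> {1..k} = {1..m + k}"
      by (simp add: skew_sum_def \<beta> k_def[symmetric])
    have "(\<lambda>v. v + k) ` set \<alpha> \<inter> {1..k} = {}"
      using all_perms_distinct[OF s] \<beta> by (auto simp: skew_sum_def k_def[symmetric])
    with U have "(\<lambda>v. v + k) ` set \<alpha> = {1..m + k} - {1..k}" by blast
    also have "\<dots> = {k + 1..k + m}" by auto
    also have "\<dots> = (\<lambda>v. v + k) ` {1..m}" by (rule image_add_atLeastAtMost_1[symmetric])
    finally have "set \<alpha> = {1..m}" by (subst (asm) inj_image_eq_iff) (simp add: inj_def)
    then show "\<alpha> \<in> all_perms" by (simp add: all_perms_def m_def)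
  qed
qed

text \<open>
  Of two skew decompositions of the same word, the one with the shorter right part refines the
  other: \<open>\<delta>\<close> consists of the letters by which the two cuts differ.
\<close>

lemma skew_sum_eq_skew_sum_le:
  assumes eq: "skew_sum \<alpha> \<beta> = skew_sum \<alpha>' \<beta>'" and le: "length \<beta>' \<le> length \<beta>"
  obtains \<delta> where "\<beta> = skew_sum \<delta> \<beta>'" "\<alpha>' = skew_sum \<alpha> \<delta>"
proof -
  define \<delta> where "\<delta> = drop (length \<alpha>) \<alpha>'"
  define \<gamma> where "\<gamma> = take (length \<alpha>) \<alpha>'"
  have len: "length \<alpha>' + length \<beta>' = length \<alpha> + length \<beta>"
    using arg_cong[OF eq, of length] by simp
  have l\<gamma>: "length \<gamma> = length \<alpha>" using len le by (simp add: \<gamma>_def)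
  have l\<delta>: "length \<delta> + length \<beta>' = length \<beta>" using len le by (simp add: \<delta>_def)
  have \<alpha>': "\<alpha>' = \<gamma> @ \<delta>" by (simp add: \<gamma>_def \<delta>_def)
  have "map (\<lambda>v. v + length \<beta>) \<alpha> @ \<beta> =
      map (\<lambda>v. v + length \<beta>') \<gamma> @ map (\<lambda>v. v + length \<beta>') \<delta> @ \<beta>'"
    using eq by (simp add: skew_sum_def \<alpha>')
  then have 1: "map (\<lambda>v. v + length \<beta>) \<alpha> = map (\<lambda>v. v + length \<beta>') \<gamma>"
    and 2: "\<beta> = skew_sum \<delta> \<beta>'"
    unfolding skew_sum_def using l\<gamma> by (metis append_eq_append_conv length_map)+
  have "map (\<lambda>v. v + length \<beta>') (map (\<lambda>v. v + length \<delta>) \<alpha>) = map (\<lambda>v. v + length \<beta>') \<gamma>"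
    using 1 unfolding l\<delta>[symmetric] map_map comp_def add.assoc .
  then have "map (\<lambda>v. v + length \<delta>) \<alpha> = \<gamma>"
    by (rule map_injective) (simp add: inj_def)
  then have "\<alpha>' = skew_sum \<alpha> \<delta>" by (simp add: \<alpha>' skew_sum_def)
  with 2 show ?thesis by (rule that)
qed

section \<open>Decompositions of a permutation around a framed block\<close>

text \<open>
  The direct sum \<open>1 \<oplus> \<mu> \<oplus> 1\<close>: the first and the last letter are those of an occurrence of the base
  pattern, \<open>\<mu>\<close> is the content of its box \<open>(1, 1)\<close>.
\<close>

definition frame_block :: "nat list \<Rightarrow> nat list" where
  "frame_block \<mu> = 1 # map Suc \<mu> @ [length \<mu> + 2]"

lemma length_frame_block [simp]: "length (frame_block \<mu>) = length \<mu> + 2"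
  by (simp add: frame_block_def)

lemma frame_block_in_all_perms: 
  assumes "\<mu> \<in> all_perms"
  shows "frame_block \<mu> \<in> all_perms"
proof -
  have "Suc ` {1..length \<mu>} = {2..length \<mu> + 1}" by (simp add: image_Suc_atLeastAtMost)
  then have "set (frame_block \<mu>) = {1, length \<mu> + 2} \<union> {2..length \<mu> + 1}"
    using assms by (auto simp: frame_block_def all_perms_def)
  also have "\<dots> = {1..length \<mu> + 2}" by auto
  finally show ?thesis by (simp add: all_perms_def)
qed

definition assemble :: "nat list \<times> nat list \<times> nat list \<Rightarrow> nat list" where
  "assemble = (\<lambda>(\<sigma>, \<mu>, \<rho>). skew_sum \<sigma> (skew_sum (frame_block \<mu>) \<rho>))"

definition frames :: "nat list \<Rightarrow> (nat list \<times> nat list \<times> nat list) set" where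
  "frames \<pi> = {t \<in> all_perms \<times> all_perms \<times> all_perms. assemble t = \<pi>}"

lemma assemble_in_all_perms: "t \<in> all_perms \<times> all_perms \<times> all_perms \<Longrightarrow> assemble t \<in> all_perms"
  by (auto simp: assemble_def skew_sum_in_all_perms_iff frame_block_in_all_perms)

lemma length_assemble: "length (assemble (\<sigma>, \<mu>, \<rho>)) = length \<sigma> + (length \<mu> + (length \<rho> + 2))"
  by (simp add: assemble_def)

lemma assemble_list:
  "assemble (\<sigma>, \<mu>, \<rho>) = map (\<lambda>v. v + (length \<mu> + 2 + length \<rho>)) \<sigma> @ (length \<rho> + 1) #
     map (\<lambda>v. v + (length \<rho> + 1)) \<mu> @ (length \<rho> + length \<mu> + 2) # \<rho>"
  by (simp add: assemble_def skew_sum_def frame_block_def comp_def add_ac)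

text \<open>
  Two frames of the same permutation do not overlap: if \<open>\<rho>'\<close> is shorter than \<open>\<rho>\<close>, the maximum
  \<open>|\<rho>'| + |\<mu>'| + 2\<close> of the block of the second frame, being its last letter, stands within \<open>\<rho>\<close>
  and hence is at most \<open>|\<rho>|\<close>.
\<close>

lemma frames_nested:
  assumes t: "(\<sigma>, \<mu>, \<rho>) \<in> frames \<pi>" and t': "(\<sigma>', \<mu>', \<rho>') \<in> frames \<pi>"
    and lt: "length \<rho>' < length \<rho>"
  shows "length (skew_sum (frame_block \<mu>') \<rho>') \<le> length \<rho>"
proof -
  define n where "n = length \<pi>"
  have \<pi>: "\<pi> = assemble (\<sigma>, \<mu>, \<rho>)" "\<pi> = assemble (\<sigma>', \<mu>', \<rho>')" and \<rho>: "set \<rho> = {1..length \<rho>}"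
    using t t' by (auto simp: frames_def all_perms_def)
  have len: "length \<sigma> + (length \<mu> + (length \<rho> + 2)) = length \<sigma>' + (length \<mu>' + (length \<rho>' + 2))"
    using \<pi> by (metis length_assemble)
  \<comment> \<open>the position, counted from 0, of the last letter of the block of the second frame\<close>
  define i where "i = length \<sigma>' + (length \<mu>' + 1)"
  have "\<pi> ! i = length \<rho>' + length \<mu>' + 2"
    unfolding \<pi>(2) assemble_list i_def by (simp add: nth_append)
  moreover have "\<pi> ! i = \<rho> ! (length \<rho> - length \<rho>' - 1)"
  proof -
    have "i = length (skew_sum \<sigma> (frame_block \<mu>)) + (length \<rho> - length \<rho>' - 1)"
      using len lt by (simp add: i_def)
    moreover have "\<pi> = map (\<lambda>v. v + length \<rho>) (skew_sum \<sigma> (frame_block \<mu>)) @ \<rho>"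
      by (simp add: \<pi>(1) assemble_def skew_sum_assoc[symmetric] skew_sum_def[of _ \<rho>])
    ultimately show ?thesis by (metis length_map nth_append_length_plus)
  qed
  moreover have "\<rho> ! (length \<rho> - length \<rho>' - 1) \<in> set \<rho>" using lt by (intro nth_mem) simp
  ultimately show ?thesis unfolding \<rho> by simp
qed

lemma assemble_eqD:
  assumes "assemble (\<sigma>, \<mu>, \<rho>) = assemble (\<sigma>', \<mu>', \<rho>')" "length \<mu> = length \<mu>'" "length \<rho> = length \<rho>'"
  shows "(\<sigma>, \<mu>, \<rho>) = (\<sigma>', \<mu>', \<rho>')"
proof -
  have "skew_sum (frame_block \<mu>) \<rho> = skew_sum (frame_block \<mu>') \<rho>'" "\<sigma> = \<sigma>'"
    using assms skew_sum_inject[of "skew_sum (frame_block \<mu>) \<rho>"] by (simp_all add: assemble_def)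
  then show ?thesis
    using assms(2,3) by (auto simp: skew_sum_inject frame_block_def dest: map_injective)
qed

text \<open>
  The length of \<open>\<rho>\<close> fixes where the block ends, and the value \<open>|\<rho>| + |\<mu>| + 2\<close> at that place
  fixes the length of \<open>\<mu>\<close>. So the frames of a permutation are linearly ordered by \<open>|\<rho>|\<close>.
\<close>

lemma frames_determined_by_rest:
  assumes t: "(\<sigma>, \<mu>, \<rho>) \<in> frames \<pi>" and t': "(\<sigma>', \<mu>', \<rho>') \<in> frames \<pi>"
    and eq: "length \<rho> = length \<rho>'"
  shows "(\<sigma>, \<mu>, \<rho>) = (\<sigma>', \<mu>', \<rho>')"
proof -
  have \<pi>: "\<pi> = assemble (\<sigma>, \<mu>, \<rho>)" "\<pi> = assemble (\<sigma>', \<mu>', \<rho>')"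
    using t t' by (auto simp: frames_def)
  have top: "\<pi> ! (length \<sigma> + (length \<mu> + 1)) = length \<rho> + length \<mu> + 2"
    unfolding \<pi>(1) assemble_list by (simp add: nth_append)
  have top': "\<pi> ! (length \<sigma>' + (length \<mu>' + 1)) = length \<rho>' + length \<mu>' + 2"
    unfolding \<pi>(2) assemble_list by (simp add: nth_append)
  have "length \<sigma> + (length \<mu> + (length \<rho> + 2)) = length \<sigma>' + (length \<mu>' + (length \<rho>' + 2))"
    using \<pi> by (metis length_assemble)
  then have "length \<sigma> + (length \<mu> + 1) = length \<sigma>' + (length \<mu>' + 1)" using eq by simp
  with top top' eq have "length \<mu> = length \<mu>'" by simp
  with \<pi> eq show ?thesis by (intro assemble_eqD) auto
qed

lemma inj_on_rest_length: "inj_on (\<lambda>(\<sigma>, \<mu>, \<rho>). length \<rho>) (frames \<pi>)"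
  using frames_determined_by_rest by (fastforce simp: inj_on_def)

lemma finite_frames: "finite (frames \<pi>)"
proof (rule finite_imageD[OF _ inj_on_rest_length])
  have "(\<lambda>(\<sigma>, \<mu>, \<rho>). length \<rho>) ` frames \<pi> \<subseteq> {..length \<pi>}"
    by (auto simp: frames_def length_assemble)
  then show "finite ((\<lambda>(\<sigma>, \<mu>, \<rho>). length \<rho>) ` frames \<pi>)" by (rule finite_subset) simp
qed

text \<open>
  The frames to the right of a given one are the frames of its last part \<open>\<rho>\<close>. This is associativity
  of the skew sum in one direction; in the other, a frame further to the right lies within \<open>\<rho>\<close> by
  \<open>frames_nested\<close>, and can be cut off from \<open>\<rho>\<close>.
\<close>

lemma frames_of_rest:
  assumes t: "(\<sigma>, \<mu>, \<rho>) \<in> frames \<pi>"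
  shows "bij_betw (\<lambda>(\<delta>, \<mu>', \<rho>'). (skew_sum (skew_sum \<sigma> (frame_block \<mu>)) \<delta>, \<mu>', \<rho>'))
    (frames \<rho>) {(\<sigma>', \<mu>', \<rho>') \<in> frames \<pi>. length \<rho>' < length \<rho>}"
proof -
  define \<alpha> where "\<alpha> = skew_sum \<sigma> (frame_block \<mu>)"
  have perm: "\<sigma> \<in> all_perms" "\<mu> \<in> all_perms" "\<rho> \<in> all_perms" and \<pi>: "\<pi> = skew_sum \<alpha> \<rho>"
    using t by (auto simp: frames_def assemble_def \<alpha>_def skew_sum_assoc)
  have \<alpha>: "\<alpha> \<in> all_perms"
    using perm by (simp add: \<alpha>_def skew_sum_in_all_perms_iff frame_block_in_all_perms)
  show ?thesis
    unfolding \<alpha>_def[symmetric]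
  proof (rule bij_betw_imageI)
    show "inj_on (\<lambda>(\<delta>, \<mu>', \<rho>'). (skew_sum \<alpha> \<delta>, \<mu>', \<rho>')) (frames \<rho>)"
      using frames_determined_by_rest by (fastforce simp: inj_on_def)
    show "(\<lambda>(\<delta>, \<mu>', \<rho>'). (skew_sum \<alpha> \<delta>, \<mu>', \<rho>')) ` frames \<rho> =
      {(\<sigma>', \<mu>', \<rho>') \<in> frames \<pi>. length \<rho>' < length \<rho>}"
    proof (intro equalityI subsetI)
      fix t' assume "t' \<in> (\<lambda>(\<delta>, \<mu>', \<rho>'). (skew_sum \<alpha> \<delta>, \<mu>', \<rho>')) ` frames \<rho>"
      then obtain \<delta> \<mu>' \<rho>' where *: "t' = (skew_sum \<alpha> \<delta>, \<mu>', \<rho>')" "(\<delta>, \<mu>', \<rho>') \<in> frames \<rho>" by auto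
      then show "t' \<in> {(\<sigma>', \<mu>', \<rho>') \<in> frames \<pi>. length \<rho>' < length \<rho>}"
        using \<alpha> by (auto simp: frames_def \<pi> assemble_def skew_sum_assoc skew_sum_in_all_perms_iff)
    next
      fix t' assume "t' \<in> {(\<sigma>', \<mu>', \<rho>') \<in> frames \<pi>. length \<rho>' < length \<rho>}"
      then obtain \<sigma>' \<mu>' \<rho>' where t': "t' = (\<sigma>', \<mu>', \<rho>')" "(\<sigma>', \<mu>', \<rho>') \<in> frames \<pi>"
        and lt: "length \<rho>' < length \<rho>" by auto
      have "skew_sum \<alpha> \<rho> = skew_sum \<sigma>' (skew_sum (frame_block \<mu>') \<rho>')"
        using t'(2) by (simp add: \<pi>[symmetric] frames_def assemble_def)
      then obtain \<delta> where \<delta>: "\<rho> = skew_sum \<delta> (skew_sum (frame_block \<mu>') \<rho>')" "\<sigma>' = skew_sum \<alpha> \<delta>"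
        using frames_nested[OF t t'(2) lt] by (rule skew_sum_eq_skew_sum_le)
      have p': "\<mu>' \<in> all_perms" "\<rho>' \<in> all_perms" using t'(2) by (auto simp: frames_def)
      then have "\<delta> \<in> all_perms"
        using perm(3) unfolding \<delta>(1)
        by (simp add: skew_sum_in_all_perms_iff frame_block_in_all_perms)
      then have "(\<delta>, \<mu>', \<rho>') \<in> frames \<rho>" using p' \<delta>(1) by (simp add: frames_def assemble_def)
      then show "t' \<in> (\<lambda>(\<delta>, \<mu>', \<rho>'). (skew_sum \<alpha> \<delta>, \<mu>', \<rho>')) ` frames \<rho>"
        unfolding t'(1) \<delta>(2) by force
    qed
  qed
qed

section \<open>A telescoping identity\<close>

text \<open>
  Induction by adding an element \<open>x\<close> of largest key: its own term is \<open>(1 - w x) \<Prod>\<^sub>S w\<close>, and the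
  remaining terms do not change.
\<close>

lemma one_minus_prod_telescope:
  fixes w :: "'a \<Rightarrow> 'b :: comm_ring_1" and key :: "'a \<Rightarrow> nat"
  assumes "finite S" "inj_on key S"
  shows "1 - (\<Prod>t\<in>S. w t) = (\<Sum>t\<in>S. (1 - w t) * (\<Prod>s | s \<in> S \<and> key s < key t. w s))"
  using assms
proof (induction S rule: finite_ranking_induct[where f = key])
  case empty
  then show ?case by simp
next
  case (insert x S)
  show ?case
  proof (cases "x \<in> S")
    case True
    then show ?thesis using insert by (simp add: insert_absorb)
  next
    case False
    have less: "key y < key x" if "y \<in> S" for y
      using insert.hyps(2)[OF that] insert.prems that False by (auto simp: le_less inj_on_def)
    have x: "{s. s \<in> insert x S \<and> key s < key x} = S" using less by auto
    have S: "{s. s \<in> insert x S \<and> key s < key t} = {s. s \<in> S \<and> key s < key t}" if "t \<in> S" for t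
      using less[OF that] by auto
    have IH: "(\<Sum>t\<in>S. (1 - w t) * (\<Prod>s | s \<in> S \<and> key s < key t. w s)) = 1 - prod w S"
      using insert by simp
    have "(\<Sum>t\<in>insert x S. (1 - w t) * (\<Prod>s | s \<in> insert x S \<and> key s < key t. w s)) =
        (1 - w x) * prod w S + (\<Sum>t\<in>S. (1 - w t) * (\<Prod>s | s \<in> S \<and> key s < key t. w s))"
      unfolding sum.insert[OF insert.hyps(1) False] x by (simp only: S cong: sum.cong)
    then show ?thesis
      unfolding IH using insert.hyps(1) False by (simp add: algebra_simps)
  qed
qed

section \<open>Occurrences of the base pattern as decompositions\<close>

abbreviation base_pattern :: mesh_pattern where
  "base_pattern \<equiv> ([1, 2], {(0,0), (0,1), (1,0), (1,2), (2,1), (2,2)})"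

lemma is_mesh_pattern_base: "is_mesh_pattern base_pattern"
  by (auto simp: is_mesh_pattern_def intro!: permutations_of_setI)

lemma below_count_pair:
  "i < j \<Longrightarrow> below_count g {i, j} x = (if g i < g x then 1 else 0) + (if g j < g x then 1 else 0)"
proof -
  assume "i < j"
  have "{a \<in> {i, j}. g a < g x} = (if g i < g x then {i} else {}) \<union> (if g j < g x then {j} else {})"
    by auto
  then show ?thesis using \<open>i < j\<close> by (auto simp: below_count_def)
qed

text \<open>
  The three columns left open by \<open>i\<close> and \<open>j\<close> each have a single unshaded box: the top one on the
  left, the middle one in the middle and the bottom one on the right.
\<close>

lemma occurrences_base_pair_iff:
  assumes \<pi>: "\<pi> \<in> perms n" and ij: "i \<in> {1..n}" "j \<in> {1..n}" "i < j"
  defines "e \<equiv> entry \<pi>"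
  shows "{i, j} \<in> occurrences base_pattern \<pi> \<longleftrightarrow> e i < e j \<and>
    (\<forall>x\<in>{1..<i}. e j < e x) \<and> (\<forall>x\<in>{i<..<j}. e i < e x \<and> e x < e j) \<and> (\<forall>x\<in>{j<..n}. e x < e i)"
proof -
  have inj: "inj_on e {1..n}" unfolding e_def by (rule entry_inj[OF \<pi>]) simp
  have ne: "e x \<noteq> e i" "e x \<noteq> e j" if "x \<in> {1..n} - {i, j}" for x
    using that ij inj by (auto dest: inj_onD)
  have box: "(below_count id {i, j} x, below_count e {i, j} x) \<notin> snd base_pattern \<longleftrightarrow>
      (x < i \<longrightarrow> e j < e x) \<and> (i < x \<longrightarrow> x < j \<longrightarrow> e i < e x \<and> e x < e j) \<and> (j < x \<longrightarrow> e x < e i)"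
    if "x \<in> {1..n} - {i, j}" "e i < e j" for x
    using that ne[OF that(1)] ij(3) by (auto simp: below_count_pair)
  have all: "(\<forall>x\<in>{1..n} - {i, j}. (below_count id {i, j} x, below_count e {i, j} x) \<notin> snd base_pattern) \<longleftrightarrow>
      (\<forall>x\<in>{1..<i}. e j < e x) \<and> (\<forall>x\<in>{i<..<j}. e i < e x \<and> e x < e j) \<and> (\<forall>x\<in>{j<..n}. e x < e i)"
    if "e i < e j"
  proof -
    have "(\<forall>x\<in>{1..n} - {i, j}. (below_count id {i, j} x, below_count e {i, j} x) \<notin> snd base_pattern) \<longleftrightarrow>
      (\<forall>x\<in>{1..n} - {i, j}. (x < i \<longrightarrow> e j < e x) \<and> (i < x \<longrightarrow> x < j \<longrightarrow> e i < e x \<and> e x < e j) \<and>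
         (j < x \<longrightarrow> e x < e i))"
      using box[OF _ that] by blast
    also have "\<dots> \<longleftrightarrow> (\<forall>x\<in>{1..<i}. e j < e x) \<and> (\<forall>x\<in>{i<..<j}. e i < e x \<and> e x < e j) \<and>
        (\<forall>x\<in>{j<..n}. e x < e i)"
      using ij by (auto simp: Ball_def)
    finally show ?thesis .
  qed
  have word: "(\<forall>x\<in>{i, j}. fst base_pattern ! below_count id {i, j} x = Suc (below_count e {i, j} x)) \<longleftrightarrow> e i < e j"
    using ij(3) by (auto simp: below_count_pair)
  have "card {i, j} = length (fst base_pattern)" using ij(3) by simp
  then show ?thesis
    unfolding occurrences_iff[OF \<pi> is_mesh_pattern_base] e_def[symmetric] word
    using all ij by blast
qed

lemma mesh_box_base_occurrence:
  assumes \<pi>: "\<pi> \<in> perms n" and ij: "i \<in> {1..n}" "j \<in> {1..n}" "i < j"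
    and occ: "{i, j} \<in> occurrences base_pattern \<pi>"
  shows "mesh_box \<pi> {i, j} (1, 1) = {i<..<j}"
proof -
  have e: "entry \<pi> i < entry \<pi> j" "\<forall>x\<in>{i<..<j}. entry \<pi> i < entry \<pi> x \<and> entry \<pi> x < entry \<pi> j"
    using occ occurrences_base_pair_iff[OF \<pi> ij] by auto
  have "x \<in> mesh_box \<pi> {i, j} (1, 1) \<longleftrightarrow>
      x \<in> {1..n} - {i, j} \<and> below_count id {i, j} x = 1 \<and> below_count (entry \<pi>) {i, j} x = 1" for x
    by (rule mem_mesh_box[OF \<pi>]) (use ij in auto)
  also have "\<dots> x \<longleftrightarrow> x \<in> {1..n} - {i, j} \<and> i < x \<and> x < j \<and> entry \<pi> i < entry \<pi> x \<and> \<not> entry \<pi> j < entry \<pi> x" for x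
    using ij(3) e(1) by (auto simp: below_count_pair[OF ij(3)])
  also have "\<dots> x \<longleftrightarrow> x \<in> {i<..<j}" for x
    using ij e(2) by fastforce
  finally show ?thesis by blast
qed

lemma entry_image_infix: "entry (L @ M @ R) ` {length L + 1..length L + length M} = set M"
proof -
  have "{length L + 1..length L + length M} = (\<lambda>k. k + (length L + 1)) ` {0..<length M}"
    unfolding image_add_atLeastLessThan' by auto
  then have "entry (L @ M @ R) ` {length L + 1..length L + length M} =
      (\<lambda>k. entry (L @ M @ R) (k + (length L + 1))) ` {0..<length M}"
    by (simp only: image_image)
  also have "\<dots> = (!) M ` {0..<length M}"
    by (rule image_cong) (auto simp: entry_def nth_append)
  also have "\<dots> = set M" by (metis list.set_map map_nth set_upt)
  finally show ?thesis .
qed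

lemma occurrences_base_list_iff:
  fixes L M R :: "nat list" and a b :: nat
  defines "\<pi> \<equiv> L @ a # M @ b # R"
  assumes \<pi>: "\<pi> \<in> all_perms"
  shows "{length L + 1, length L + length M + 2} \<in> occurrences base_pattern \<pi> \<longleftrightarrow>
    a < b \<and> (\<forall>v\<in>set L. b < v) \<and> (\<forall>v\<in>set M. a < v \<and> v < b) \<and> (\<forall>v\<in>set R. v < a)"
proof -
  let ?i = "length L + 1" and ?j = "length L + length M + 2"
  define n where "n = length \<pi>"
  have \<pi>n: "\<pi> \<in> perms n" unfolding perms_eq_all_perms using \<pi> by (simp add: n_def)
  have n: "n = length L + length M + 2 + length R" by (simp add: n_def \<pi>_def)
  have e: "entry \<pi> ?i = a" "entry \<pi> ?j = b"
    by (simp_all add: entry_def \<pi>_def nth_append)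
  have "{1..<?i} = {length [] + 1..length ([] :: nat list) + length L}"
    "{?i<..<?j} = {length (L @ [a]) + 1..length (L @ [a]) + length M}"
    "{?j<..n} = {length (L @ a # M @ [b]) + 1..length (L @ a # M @ [b]) + length R}"
    unfolding n by auto
  moreover have "\<pi> = [] @ L @ a # M @ b # R" "\<pi> = (L @ [a]) @ M @ b # R" "\<pi> = (L @ a # M @ [b]) @ R @ []"
    by (simp_all add: \<pi>_def)
  ultimately have im: "entry \<pi> ` {1..<?i} = set L" "entry \<pi> ` {?i<..<?j} = set M" "entry \<pi> ` {?j<..n} = set R"
    using entry_image_infix by metis+
  have "{?i, ?j} \<in> occurrences base_pattern \<pi> \<longleftrightarrow> a < b \<and> (\<forall>x\<in>{1..<?i}. b < entry \<pi> x) \<and>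
      (\<forall>x\<in>{?i<..<?j}. a < entry \<pi> x \<and> entry \<pi> x < b) \<and> (\<forall>x\<in>{?j<..n}. entry \<pi> x < a)"
    unfolding e[symmetric] by (rule occurrences_base_pair_iff[OF \<pi>n]) (auto simp: n)
  then show ?thesis unfolding im[symmetric] by (simp only: ball_simps)
qed

lemma image_diff_greaterThanAtMost: "(\<lambda>v. v - b) ` {b<..n} = {1..n - b}" for b n :: nat
proof (intro equalityI subsetI)
  fix v assume "v \<in> {1..n - b}"
  then have "v = (v + b) - b" "v + b \<in> {b<..n}" by auto
  then show "v \<in> (\<lambda>v. v - b) ` {b<..n}" by blast
qed auto

text \<open>
  Since the letters are \<open>1, \<dots>, n\<close> and those of \<open>R\<close>, \<open>M\<close>, \<open>L\<close> are separated by \<open>a\<close> and \<open>b\<close>, each of the three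
  parts consists of consecutive values, and subtracting the smaller letters yields permutations.
\<close>

lemma assemble_of_occurrence:
  fixes L M R :: "nat list" and a b :: nat
  assumes \<pi>: "L @ a # M @ b # R \<in> all_perms"
    and ab: "a < b" and L: "\<forall>v\<in>set L. b < v" and M: "\<forall>v\<in>set M. a < v \<and> v < b" and R: "\<forall>v\<in>set R. v < a"
  obtains \<sigma> \<mu> \<rho> where "(\<sigma>, \<mu>, \<rho>) \<in> frames (L @ a # M @ b # R)" "length \<sigma> = length L" "length \<mu> = length M"
proof -
  define n where "n = length (L @ a # M @ b # R)"
  have set: "set (L @ a # M @ b # R) = {1..n}" using \<pi> by (simp add: all_perms_def n_def)
  have mem: "v \<in> set L \<or> v = a \<or> v \<in> set M \<or> v = b \<or> v \<in> set R \<longleftrightarrow> 1 \<le> v \<and> v \<le> n" for v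
    using arg_cong[OF set, of "\<lambda>A. v \<in> A"] by auto
  have d: "distinct L" "distinct M" "distinct R" using all_perms_distinct[OF \<pi>] by auto
  have "set R = {1..a - 1}"
  proof (intro equalityI subsetI)
    fix v assume "v \<in> set R" then show "v \<in> {1..a - 1}" using mem[of v] R by fastforce
  next
    fix v assume "v \<in> {1..a - 1}"
    then have v: "1 \<le> v" "v < a" by auto
    then have "v \<le> n" using mem[of a] by auto
    with v mem[of v] L M ab show "v \<in> set R" by fastforce
  qed
  moreover have "set M = {a<..b - 1}"
  proof (intro equalityI subsetI)
    fix v assume "v \<in> set M" then show "v \<in> {a<..b - 1}" using M by fastforce
  next
    fix v assume "v \<in> {a<..b - 1}"
    then have v: "a < v" "v < b" by auto
    then have "1 \<le> v" "v \<le> n" using mem[of b] by auto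
    with v mem[of v] L R show "v \<in> set M" by fastforce
  qed
  moreover have "set L = {b<..n}"
  proof (intro equalityI subsetI)
    fix v assume "v \<in> set L" then show "v \<in> {b<..n}" using L mem[of v] by fastforce
  next
    fix v assume "v \<in> {b<..n}"
    then have v: "b < v" "v \<le> n" by auto
    with mem[of v] M R ab show "v \<in> set L" by fastforce
  qed
  ultimately have sets: "set L = {b<..n}" "set M = {a<..b - 1}" "set R = {1..a - 1}" by auto
  have "1 \<le> a" using mem[of a] by auto
  then have len: "length L = n - b" "length M = b - 1 - a" "length R = a - 1"
    using d[THEN distinct_card] sets by simp_all
  have a: "a = length R + 1" and b: "b = length R + length M + 2"
    using len ab \<open>1 \<le> a\<close> by auto
  define \<sigma> \<mu> where "\<sigma> = map (\<lambda>v. v - b) L" and "\<mu> = map (\<lambda>v. v - a) M"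
  have "set \<sigma> = {1..length \<sigma>}" "set \<mu> = {1..length \<mu>}"
    using sets(1,2) len by (simp_all add: \<sigma>_def \<mu>_def image_diff_greaterThanAtMost)
  moreover have "set R = {1..length R}" using sets(3) len by simp
  ultimately have perm: "\<sigma> \<in> all_perms" "\<mu> \<in> all_perms" "R \<in> all_perms" by (simp_all add: all_perms_def)
  have "map (\<lambda>v. v + b) \<sigma> = L" "map (\<lambda>v. v + a) \<mu> = M"
    unfolding \<sigma>_def \<mu>_def map_map using L M by (auto intro!: map_idI)
  then have "assemble (\<sigma>, \<mu>, R) = L @ a # M @ b # R"
    unfolding assemble_list using a b by (simp add: \<sigma>_def \<mu>_def add_ac)
  with perm have "(\<sigma>, \<mu>, R) \<in> frames (L @ a # M @ b # R)" by (simp add: frames_def)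
  then show ?thesis by (rule that) (simp_all add: \<sigma>_def \<mu>_def)
qed

definition frame_positions :: "nat list \<times> nat list \<times> nat list \<Rightarrow> nat set" where
  "frame_positions = (\<lambda>(\<sigma>, \<mu>, \<rho>). {length \<sigma> + 1, length \<sigma> + length \<mu> + 2})"

lemma bij_betw_frames_occurrences:
  assumes \<pi>: "\<pi> \<in> all_perms"
  shows "bij_betw frame_positions (frames \<pi>) (occurrences base_pattern \<pi>)"
proof (rule bij_betw_imageI)
  show "inj_on frame_positions (frames \<pi>)"
  proof (rule inj_onI, unfold split_paired_all)
    fix \<sigma> \<mu> \<rho> \<sigma>' \<mu>' \<rho>'
    assume t: "(\<sigma>, \<mu>, \<rho>) \<in> frames \<pi>" "(\<sigma>', \<mu>', \<rho>') \<in> frames \<pi>"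
      and eq: "frame_positions (\<sigma>, \<mu>, \<rho>) = frame_positions (\<sigma>', \<mu>', \<rho>')"
    have as: "assemble (\<sigma>, \<mu>, \<rho>) = assemble (\<sigma>', \<mu>', \<rho>')" using t by (simp add: frames_def)
    have "length \<sigma> = length \<sigma>'" "length \<mu> = length \<mu>'"
      using eq by (auto simp: frame_positions_def doubleton_eq_iff)
    moreover from this have "length \<rho> = length \<rho>'" using arg_cong[OF as, of length] by (simp add: length_assemble)
    ultimately show "(\<sigma>, \<mu>, \<rho>) = (\<sigma>', \<mu>', \<rho>')" by (intro assemble_eqD[OF as])
  qed
  show "frame_positions ` frames \<pi> = occurrences base_pattern \<pi>"
  proof (intro equalityI subsetI)
    fix I assume "I \<in> frame_positions ` frames \<pi>"
    then obtain \<sigma> \<mu> \<rho> where t: "(\<sigma>, \<mu>, \<rho>) \<in> frames \<pi>" and I: "I = frame_positions (\<sigma>, \<mu>, \<rho>)" by auto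
    have perm: "set \<sigma> = {1..length \<sigma>}" "set \<mu> = {1..length \<mu>}" "set \<rho> = {1..length \<rho>}"
      and as: "\<pi> = assemble (\<sigma>, \<mu>, \<rho>)"
      using t by (auto simp: frames_def all_perms_def)
    show "I \<in> occurrences base_pattern \<pi>"
      using occurrences_base_list_iff[OF \<pi>[unfolded as assemble_list]] perm
      by (simp add: I frame_positions_def as assemble_list)
  next
    fix I assume I: "I \<in> occurrences base_pattern \<pi>"
    define n where "n = length \<pi>"
    have "\<pi> \<in> perms n" unfolding perms_eq_all_perms using \<pi> by (simp add: n_def)
    from I[unfolded occurrences_iff[OF this is_mesh_pattern_base]]
    have I2: "I \<subseteq> {1..n}" "card I = 2" by auto
    then obtain i j where ij: "I = {i, j}" "i < j"
      by (metis card_2_iff insert_commute linorder_neqE_nat)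
    then have i: "1 \<le> i" "j \<le> n" using I2 by auto
    define L M R where "L = take (i - 1) \<pi>" and "M = take (j - i - 1) (drop i \<pi>)" and "R = drop j \<pi>"
    define a b where "a = \<pi> ! (i - 1)" and "b = \<pi> ! (j - 1)"
    have "\<pi> = L @ a # drop i \<pi>"
      using id_take_nth_drop[of "i - 1" \<pi>] i ij(2) by (simp add: L_def a_def n_def)
    moreover have "drop i \<pi> = M @ b # R"
      using id_take_nth_drop[of "j - i - 1" "drop i \<pi>"] i ij(2) by (simp add: M_def b_def R_def n_def)
    ultimately have split: "\<pi> = L @ a # M @ b # R" by simp
    have len: "length L + 1 = i" "length L + length M + 2 = j"
      using i ij(2) by (auto simp: L_def M_def n_def)
    have "{length L + 1, length L + length M + 2} \<in> occurrences base_pattern (L @ a # M @ b # R)"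
      using I unfolding ij(1) len split .
    then have cond: "a < b" "\<forall>v\<in>set L. b < v" "\<forall>v\<in>set M. a < v \<and> v < b" "\<forall>v\<in>set R. v < a"
      unfolding occurrences_base_list_iff[OF \<pi>[unfolded split]] by auto
    obtain \<sigma> \<mu> \<rho> where t: "(\<sigma>, \<mu>, \<rho>) \<in> frames \<pi>" and l: "length \<sigma> = length L" "length \<mu> = length M"
      using assemble_of_occurrence[OF \<pi>[unfolded split] cond] unfolding split .
    have "I = frame_positions (\<sigma>, \<mu>, \<rho>)"
      unfolding frame_positions_def prod.case l len ij(1) by (rule refl)
    with t show "I \<in> frame_positions ` frames \<pi>" by blast
  qed
qed

lemma standardize_shifted:
  assumes "\<mu> \<in> all_perms"
  shows "standardize (map (\<lambda>v. v + c) \<mu>) = \<mu>"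
proof -
  have \<mu>: "set \<mu> = {1..length \<mu>}" using assms by (simp add: all_perms_def)
  have "card {y \<in> (\<lambda>v. v + c) ` set \<mu>. y \<le> x + c} = x" if "x \<in> set \<mu>" for x
  proof -
    have "{y \<in> (\<lambda>v. v + c) ` set \<mu>. y \<le> x + c} = (\<lambda>v. v + c) ` {1..x}"
      using that unfolding \<mu> by auto
    also have "card \<dots> = x" by (simp add: card_image)
    finally show ?thesis .
  qed
  then show ?thesis by (simp add: standardize_def map_idI)
qed

lemma box_perm_frame:
  assumes t: "(\<sigma>, \<mu>, \<rho>) \<in> frames \<pi>"
  shows "box_perm \<pi> (frame_positions (\<sigma>, \<mu>, \<rho>)) (1, 1) = \<mu>"
proof -
  let ?i = "length \<sigma> + 1" and ?j = "length \<sigma> + length \<mu> + 2"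
  define n where "n = length \<pi>"
  have perm: "\<mu> \<in> all_perms" and as: "\<pi> = assemble (\<sigma>, \<mu>, \<rho>)" and \<pi>: "\<pi> \<in> all_perms"
    using t assemble_in_all_perms by (auto simp: frames_def)
  have \<pi>n: "\<pi> \<in> perms n" unfolding perms_eq_all_perms using \<pi> by (simp add: n_def)
  have n: "n = length \<sigma> + length \<mu> + 2 + length \<rho>" by (simp add: n_def as length_assemble)
  have occ: "{?i, ?j} \<in> occurrences base_pattern \<pi>"
    using bij_betw_imp_surj_on[OF bij_betw_frames_occurrences[OF \<pi>]] t by (force simp: frame_positions_def)
  have box: "mesh_box \<pi> {?i, ?j} (1, 1) = {?i<..<?j}"
    by (rule mesh_box_base_occurrence[OF \<pi>n _ _ _ occ]) (simp_all add: n)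
  have "subword \<pi> {?i<..<?j} = map (\<lambda>v. v + (length \<rho> + 1)) \<mu>"
  proof -
    have "sorted_list_of_set {?i<..<?j} = [Suc ?i..<?j]"
      by (metis atLeastSucLessThan_greaterThanLessThan sorted_list_of_set_range)
    moreover have "map (entry \<pi>) [Suc ?i..<?j] = map (\<lambda>v. v + (length \<rho> + 1)) \<mu>"
    proof (rule nth_equalityI)
      fix k assume "k < length (map (entry \<pi>) [Suc ?i..<?j])"
      then have "k < length \<mu>" by (simp del: upt_Suc)
      then have "entry \<pi> (Suc ?i + k) = \<mu> ! k + (length \<rho> + 1)"
        by (simp add: entry_def as assemble_list nth_append)
      with \<open>k < length \<mu>\<close> show "map (entry \<pi>) [Suc ?i..<?j] ! k = map (\<lambda>v. v + (length \<rho> + 1)) \<mu> ! k"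
        by (simp del: upt_Suc)
    qed (simp del: upt_Suc)
    ultimately show ?thesis by (simp only: subword_def)
  qed
  then show ?thesis
    unfolding box_perm_def frame_positions_def prod.case box by (simp only: standardize_shifted[OF perm])
qed

lemma finite_occurrences: "finite (occurrences p \<pi>)"
  by (rule finite_subset[of _ "Pow {1..length \<pi>}"]) (auto simp: occurrences_def)

text \<open>
  An occurrence of the inserted pattern is a pair of a base occurrence, that is, of a frame, and an
  occurrence of \<open>p\<close> in the content \<open>\<mu>\<close> of its box.
\<close>

lemma occ_count_mesh_insert:
  assumes p: "is_mesh_pattern p" and \<pi>: "\<pi> \<in> all_perms"
  shows "occ_count (mesh_insert base_pattern (1, 1) p) \<pi> = (\<Sum>(\<sigma>, \<mu>, \<rho>)\<in>frames \<pi>. occ_count p \<mu>)"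
proof -
  have \<pi>n: "\<pi> \<in> perms (length \<pi>)" unfolding perms_eq_all_perms using \<pi> by simp
  have "occ_count (mesh_insert base_pattern (1, 1) p) \<pi> =
      card (SIGMA I:occurrences base_pattern \<pi>. occurrences p (box_perm \<pi> I (1, 1)))"
    unfolding occ_count_def
    by (rule bij_betw_same_card[OF occurrences_mesh_insert[OF \<pi>n is_mesh_pattern_base p], symmetric]) auto
  also have "\<dots> = (\<Sum>I\<in>occurrences base_pattern \<pi>. occ_count p (box_perm \<pi> I (1, 1)))"
    unfolding occ_count_def by (simp add: card_SigmaI finite_occurrences)
  also have "\<dots> = (\<Sum>t\<in>frames \<pi>. occ_count p (box_perm \<pi> (frame_positions t) (1, 1)))"
    by (rule sum.reindex_bij_betw[OF bij_betw_frames_occurrences[OF \<pi>], symmetric])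
  also have "\<dots> = (\<Sum>(\<sigma>, \<mu>, \<rho>)\<in>frames \<pi>. occ_count p \<mu>)"
    by (rule sum.cong) (auto simp: box_perm_frame simp del: One_nat_def)
  finally show ?thesis .
qed

section \<open>Generating functions of weighted objects\<close>

unbundle fps_syntax

definition weighted_gf :: "'s set \<Rightarrow> ('s \<Rightarrow> nat) \<Rightarrow> ('s \<Rightarrow> 'a :: comm_ring_1) \<Rightarrow> 'a fps" where
  "weighted_gf S sz u = Abs_fps (\<lambda>n. \<Sum>s | s \<in> S \<and> sz s = n. u s)"

lemma finite_pairs_of_total_size:
  fixes sz :: "'s \<Rightarrow> nat" and sz' :: "'t \<Rightarrow> nat"
  assumes S: "\<And>n. finite {s \<in> S. sz s = n}" and T: "\<And>n. finite {t \<in> T. sz' t = n}"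
  shows "finite {p \<in> S \<times> T. (case p of (s, t) \<Rightarrow> sz s + sz' t) = n}"
proof (rule finite_subset)
  show "{p \<in> S \<times> T. (case p of (s, t) \<Rightarrow> sz s + sz' t) = n} \<subseteq>
      (\<Union>i\<in>{0..n}. {s \<in> S. sz s = i} \<times> {t \<in> T. sz' t = n - i})"
    by auto
  show "finite (\<Union>i\<in>{0..n}. {s \<in> S. sz s = i} \<times> {t \<in> T. sz' t = n - i})"
    using S T by (intro finite_UN_I finite_cartesian_product) auto
qed

lemma weighted_gf_mult:
  assumes S: "\<And>n. finite {s \<in> S. sz s = n}" and T: "\<And>n. finite {t \<in> T. sz' t = n}"
  shows "weighted_gf S sz u * weighted_gf T sz' v =
    weighted_gf (S \<times> T) (\<lambda>(s, t). sz s + sz' t) (\<lambda>(s, t). u s * v t)"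
proof (rule fps_ext)
  fix n
  let ?P = "{p \<in> S \<times> T. (case p of (s, t) \<Rightarrow> sz s + sz' t) = n}"
  have slice: "{p \<in> ?P. sz (fst p) = i} = {s \<in> S. sz s = i} \<times> {t \<in> T. sz' t = n - i}" if "i \<in> {0..n}" for i
    using that by auto
  have fin: "finite ?P" by (rule finite_pairs_of_total_size[OF S T])
  have "(weighted_gf S sz u * weighted_gf T sz' v) $ n =
      (\<Sum>i = 0..n. (\<Sum>s | s \<in> S \<and> sz s = i. u s) * (\<Sum>t | t \<in> T \<and> sz' t = n - i. v t))"
    by (simp add: fps_mult_nth weighted_gf_def)
  also have "\<dots> = (\<Sum>i = 0..n. \<Sum>(s, t)\<in>{p \<in> ?P. sz (fst p) = i}. u s * v t)"
    by (rule sum.cong[OF refl]) (simp only: slice sum_product sum.cartesian_product)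
  also have "\<dots> = (\<Sum>(s, t)\<in>?P. u s * v t)"
    by (rule sum.group[OF fin]) auto
  finally show "(weighted_gf S sz u * weighted_gf T sz' v) $ n =
      weighted_gf (S \<times> T) (\<lambda>(s, t). sz s + sz' t) (\<lambda>(s, t). u s * v t) $ n"
    by (simp add: weighted_gf_def)
qed

lemma weighted_gf_shift: "weighted_gf S (\<lambda>s. sz s + k) u = fps_X ^ k * weighted_gf S sz u"
  by (rule fps_ext) (auto simp: weighted_gf_def fps_X_power_mult_nth intro!: sum.cong)

lemma weighted_gf_diff: "weighted_gf S sz u - weighted_gf S sz v = weighted_gf S sz (\<lambda>s. u s - v s)"
  by (rule fps_ext) (simp add: weighted_gf_def sum_subtractf)

text \<open>
  A common generalization of the two series of the theorem: the distribution for an arbitrary value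
  of \<open>q\<close> instead of an indeterminate.
\<close>

definition occ_gf :: "'a :: comm_ring_1 \<Rightarrow> mesh_pattern \<Rightarrow> 'a fps" where
  "occ_gf q p = weighted_gf all_perms length (\<lambda>\<pi>. q ^ occ_count p \<pi>)"

lemma fact_gf_eq_weighted_gf: "fact_gf = weighted_gf all_perms length (\<lambda>_. 1 :: 'a :: comm_ring_1)"
proof (rule fps_ext)
  fix n
  have "weighted_gf all_perms length (\<lambda>_. 1) $ n = (\<Sum>\<pi>\<in>perms n. 1 :: 'a)"
    by (simp only: weighted_gf_def fps_nth_Abs_fps perms_eq_all_perms)
  then show "fact_gf $ n = (weighted_gf all_perms length (\<lambda>_. 1) $ n :: 'a)" by (simp add: fact_gf_def)
qed

text \<open>
  The telescoping identity applied to the weights \<open>q ^ p(\<mu>)\<close> of the frames, ordered by \<open>|\<rho>|\<close>: the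
  product over the frames with a smaller key is a product over the frames of \<open>\<rho>\<close>, hence equal to the
  weight of \<open>\<rho>\<close>.
\<close>

lemma one_minus_power_occ_count:
  fixes q :: "'a :: comm_ring_1"
  assumes p: "is_mesh_pattern p" and \<pi>: "\<pi> \<in> all_perms"
  defines "p' \<equiv> mesh_insert base_pattern (1, 1) p"
  shows "1 - q ^ occ_count p' \<pi> =
    (\<Sum>(\<sigma>, \<mu>, \<rho>)\<in>frames \<pi>. (1 - q ^ occ_count p \<mu>) * q ^ occ_count p' \<rho>)"
proof -
  define w :: "nat list \<times> nat list \<times> nat list \<Rightarrow> 'a" where "w = (\<lambda>(\<sigma>, \<mu>, \<rho>). q ^ occ_count p \<mu>)"
  define key :: "nat list \<times> nat list \<times> nat list \<Rightarrow> nat" where "key = (\<lambda>(\<sigma>, \<mu>, \<rho>). length \<rho>)"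
  have weight: "q ^ occ_count p' \<rho> = prod w (frames \<rho>)" if "\<rho> \<in> all_perms" for \<rho>
    unfolding p'_def occ_count_mesh_insert[OF p that] power_sum
    by (rule prod.cong) (auto simp: w_def)
  have "1 - q ^ occ_count p' \<pi> = (\<Sum>t\<in>frames \<pi>. (1 - w t) * (\<Prod>s | s \<in> frames \<pi> \<and> key s < key t. w s))"
    unfolding weight[OF \<pi>]
    by (rule one_minus_prod_telescope[OF finite_frames]) (simp add: key_def inj_on_rest_length)
  also have "\<dots> = (\<Sum>(\<sigma>, \<mu>, \<rho>)\<in>frames \<pi>. (1 - q ^ occ_count p \<mu>) * q ^ occ_count p' \<rho>)"
  proof (rule sum.cong[OF refl], unfold split_paired_all prod.case)
    fix \<sigma> \<mu> \<rho> assume t: "(\<sigma>, \<mu>, \<rho>) \<in> frames \<pi>"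
    then have \<rho>: "\<rho> \<in> all_perms" by (simp add: frames_def)
    have "prod w {s. s \<in> frames \<pi> \<and> key s < length \<rho>} =
        prod (\<lambda>s. w (case s of (\<delta>, \<mu>', \<rho>') \<Rightarrow> (skew_sum (skew_sum \<sigma> (frame_block \<mu>)) \<delta>, \<mu>', \<rho>'))) (frames \<rho>)"
    proof (rule prod.reindex_bij_betw[symmetric])
      have "{s. s \<in> frames \<pi> \<and> key s < length \<rho>} = {(\<sigma>', \<mu>', \<rho>') \<in> frames \<pi>. length \<rho>' < length \<rho>}"
        by (auto simp: key_def)
      then show "bij_betw (\<lambda>s. case s of (\<delta>, \<mu>', \<rho>') \<Rightarrow> (skew_sum (skew_sum \<sigma> (frame_block \<mu>)) \<delta>, \<mu>', \<rho>'))
        (frames \<rho>) {s. s \<in> frames \<pi> \<and> key s < length \<rho>}"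
        using frames_of_rest[OF t] by simp
    qed
    also have "\<dots> = prod w (frames \<rho>)" by (rule prod.cong) (auto simp: w_def)
    also have "\<dots> = q ^ occ_count p' \<rho>" by (rule weight[OF \<rho>, symmetric])
    finally show "(1 - w (\<sigma>, \<mu>, \<rho>)) * (\<Prod>s | s \<in> frames \<pi> \<and> key s < key (\<sigma>, \<mu>, \<rho>). w s) =
        (1 - q ^ occ_count p \<mu>) * q ^ occ_count p' \<rho>"
      by (simp add: key_def w_def)
  qed
  finally show ?thesis .
qed

text \<open>
  Every triple of permutations is a frame of exactly one permutation, so a sum over permutations and
  their frames is a sum over all triples.
\<close>

lemma weighted_gf_assemble:
  "weighted_gf all_perms length (\<lambda>\<pi>. \<Sum>t\<in>frames \<pi>. u t) =
   weighted_gf (all_perms \<times> all_perms \<times> all_perms) (\<lambda>t. length (assemble t)) u"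
proof (rule fps_ext)
  fix n
  let ?T = "{t \<in> all_perms \<times> all_perms \<times> all_perms. length (assemble t) = n}"
  have fr: "frames \<pi> = {t \<in> ?T. assemble t = \<pi>}" if "\<pi> \<in> {\<pi> \<in> all_perms. length \<pi> = n}" for \<pi>
    using that by (auto simp: frames_def)
  have "?T = (\<Union>\<pi>\<in>{\<pi> \<in> all_perms. length \<pi> = n}. frames \<pi>)"
    using assemble_in_all_perms by (auto simp: frames_def)
  then have fin: "finite ?T" using finite_all_perms_length[of n] finite_frames by simp
  have "(\<Sum>\<pi> | \<pi> \<in> all_perms \<and> length \<pi> = n. \<Sum>t\<in>frames \<pi>. u t) =
      (\<Sum>\<pi> | \<pi> \<in> all_perms \<and> length \<pi> = n. \<Sum>t\<in>{t \<in> ?T. assemble t = \<pi>}. u t)"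
    using fr by (intro sum.cong[OF refl]) auto
  also have "\<dots> = sum u ?T"
    using assemble_in_all_perms by (intro sum.group[OF fin finite_all_perms_length]) auto
  finally show "weighted_gf all_perms length (\<lambda>\<pi>. \<Sum>t\<in>frames \<pi>. u t) $ n =
      weighted_gf (all_perms \<times> all_perms \<times> all_perms) (\<lambda>t. length (assemble t)) u $ n"
    by (simp add: weighted_gf_def)
qed

lemma weighted_gf_cong:
  "(\<And>s. s \<in> S \<Longrightarrow> sz s = sz' s) \<Longrightarrow> (\<And>s. s \<in> S \<Longrightarrow> u s = v s) \<Longrightarrow> weighted_gf S sz u = weighted_gf S sz' v"
  by (rule fps_ext) (auto simp: weighted_gf_def intro!: sum.cong)

text \<open>
  With \<open>p'\<close> the pattern obtained by insertion, \<open>F - F\<^sub>p\<^sub>'\<close> is the generating function of the triples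
  \<open>(\<sigma>, \<mu>, \<rho>)\<close> with the weight \<open>(1 - q ^ p(\<mu>)) q ^ p'(\<rho>)\<close>, in which \<open>\<sigma>\<close> contributes \<open>F\<close>, \<open>\<mu>\<close>
  contributes \<open>F - F\<^sub>p\<close>, \<open>\<rho>\<close> contributes \<open>F\<^sub>p\<^sub>'\<close>, and the two letters of the frame contribute \<open>x\<^sup>2\<close>.
\<close>

lemma occ_gf_mesh_insert:
  fixes q :: "'a :: comm_ring_1"
  assumes p: "is_mesh_pattern p"
  defines "p' \<equiv> mesh_insert base_pattern (1, 1) p"
  shows "occ_gf q p' * (1 + fps_X ^ 2 * (fact_gf - occ_gf q p) * fact_gf) = fact_gf"
proof -
  note fin = finite_all_perms_length
  have "fact_gf - occ_gf q p' =
      weighted_gf all_perms length (\<lambda>\<pi>. \<Sum>(\<sigma>, \<mu>, \<rho>)\<in>frames \<pi>. (1 - q ^ occ_count p \<mu>) * q ^ occ_count p' \<rho>)"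
    unfolding fact_gf_eq_weighted_gf occ_gf_def weighted_gf_diff p'_def
    by (rule weighted_gf_cong[OF refl one_minus_power_occ_count[OF p]])
  \<comment> \<open>the factor 1 is the weight of \<open>\<sigma>\<close>, so that the weight has the form of a product series\<close>
  also have "\<dots> = weighted_gf (all_perms \<times> all_perms \<times> all_perms)
      (\<lambda>t. (case t of (\<sigma>, \<mu>, \<rho>) \<Rightarrow> length \<sigma> + (length \<mu> + length \<rho>)) + 2)
      (\<lambda>(\<sigma>, \<mu>, \<rho>). 1 * ((1 - q ^ occ_count p \<mu>) * q ^ occ_count p' \<rho>))"
    unfolding weighted_gf_assemble by (rule weighted_gf_cong) (auto simp: length_assemble)
  also have "\<dots> = fps_X ^ 2 * (fact_gf * ((fact_gf - occ_gf q p) * occ_gf q p'))"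
  proof -
    have pair: "(fact_gf - occ_gf q p) * occ_gf q p' = weighted_gf (all_perms \<times> all_perms)
        (\<lambda>(\<mu>, \<rho>). length \<mu> + length \<rho>) (\<lambda>(\<mu>, \<rho>). (1 - q ^ occ_count p \<mu>) * q ^ occ_count p' \<rho>)"
      unfolding fact_gf_eq_weighted_gf occ_gf_def weighted_gf_diff by (rule weighted_gf_mult[OF fin fin])
    have "fact_gf * ((fact_gf - occ_gf q p) * occ_gf q p') =
        weighted_gf (all_perms \<times> all_perms \<times> all_perms)
         (\<lambda>(\<sigma>, t). length \<sigma> + (case t of (\<mu>, \<rho>) \<Rightarrow> length \<mu> + length \<rho>))
         (\<lambda>(\<sigma>, t). 1 * (case t of (\<mu>, \<rho>) \<Rightarrow> (1 - q ^ occ_count p \<mu>) * q ^ occ_count p' \<rho>))"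
      unfolding pair unfolding fact_gf_eq_weighted_gf
      by (rule weighted_gf_mult[OF fin finite_pairs_of_total_size[OF fin fin]])
    then show ?thesis
      unfolding weighted_gf_shift by (simp add: case_prod_unfold)
  qed
  finally show ?thesis by (simp add: algebra_simps)
qed

lemma occ_gf_nth: "occ_gf q p $ n = (\<Sum>\<pi>\<in>perms n. q ^ occ_count p \<pi>)"
  by (simp only: occ_gf_def weighted_gf_def fps_nth_Abs_fps perms_eq_all_perms)

lemma distr_gf_eq_occ_gf: "distr_gf p = occ_gf fps_X p"
  by (rule fps_ext) (simp add: distr_gf_def occ_gf_nth del: One_nat_def)

lemma avoid_gf_eq_occ_gf: "avoid_gf p = occ_gf 0 p"
proof (rule fps_ext)
  fix n
  have "(\<Sum>\<pi>\<in>perms n. 0 ^ occ_count p \<pi>) = (\<Sum>\<pi>\<in>perms n. if occ_count p \<pi> = 0 then 1 else 0 :: rat)"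
    by (rule sum.cong) (auto simp: power_0_left)
  also have "\<dots> = of_nat (card {\<pi> \<in> perms n. occ_count p \<pi> = 0})"
    by (simp add: sum.If_cases Int_def del: One_nat_def)
  finally show "avoid_gf p $ n = occ_gf 0 p $ n"
    by (simp only: avoid_gf_def occ_gf_nth fps_nth_Abs_fps)
qed

theorem theorem3p5:
  fixes p1 p :: mesh_pattern
  assumes "is_mesh_pattern p1"
    and "p = mesh_insert ([1, 2], {(0,0), (0,1), (1,0), (1,2), (2,1), (2,2)}) (1, 1) p1"
  shows "avoid_gf p = fact_gf / (1 + fps_X^2 * (fact_gf - avoid_gf p1) * fact_gf) \<and>
         distr_gf p = fact_gf / (1 + fps_X^2 * (fact_gf - distr_gf p1) * fact_gf)"
proof
  let ?d = "1 + fps_X^2 * (fact_gf - avoid_gf p1) * fact_gf"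
  have "avoid_gf p * ?d = fact_gf"
    unfolding assms(2) avoid_gf_eq_occ_gf by (rule occ_gf_mesh_insert[OF assms(1)])
  moreover have "?d $ 0 = 1" by (simp add: fps_mult_nth)
  then have "?d \<noteq> 0" by (metis fps_zero_nth zero_neq_one)
  ultimately show "avoid_gf p = fact_gf / ?d" by (metis nonzero_mult_div_cancel_right)
next
  let ?d = "1 + fps_X^2 * (fact_gf - distr_gf p1) * fact_gf"
  have "distr_gf p * ?d = fact_gf"
    unfolding assms(2) distr_gf_eq_occ_gf by (rule occ_gf_mesh_insert[OF assms(1)])
  moreover have d0: "?d $ 0 = 1" by (simp add: fps_mult_nth)
  moreover have "?d \<noteq> 0" using d0 by (metis fps_zero_nth zero_neq_one)
  ultimately show "distr_gf p = fact_gf / ?d"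
    by (metis fps_fps_divide_times mult_right_cancel)
qed

end
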